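(* Let $k \geqslant 1$ and let $\Gamma$ be a labeled directed graph in which every vertex has $k$ outgoing edges, labeled by $1,\dots,k$ (exactly one outgoing edge for each label). Then $\Gamma$ is automatic if and only if there exists a Turing transducer $T \in \mathcal{T}$ such that $\Gamma \cong \Gamma_T$ (isomorphism of labeled directed graphs).
   Context: **Class $\mathcal{T}$.** A $(k+1)$-tape Turing transducer ($k\geqslant 1$) is a deterministic multi-tape Turing machine with one input tape and $k$ output tapes. The class $\mathcal{T}$ consists of those $(k+1)$-tape Turing transducers $T$ (for any $k\geqslant 1$ and any finite input alphabet $\Sigma$) that work as follows on every input $x\in\Sigma^*$. Initially $x$ is on the input tape, the output tapes are completely blank, and all heads are over the leftmost cells. First all heads move synchronously from left to right until the end of the input $x$; then they make a finite number (possibly zero) of further steps to the right, this number being bounded above by a constant depending only on $T$; after that all heads move synchronously from right to left until $T$ enters a final state with all heads over the leftmost cells. $T$ accepts $x$ if this final state is accepting, otherwise it rejects $x$. Let $L\subseteq\Sigma^*$ be the set of inputs accepted by $T$. For $x\in L$, $T$ translates $x$ into the outputs $y_1,\dots,y_k$ if, on input $x$, $T$ halts with the word $y_i$ on the $i$th output tape for $i=1,\dots,k$. It is required that $y_i\in L$ for all $x\in L$ and all $i$. If $L'\subseteq L^k$ is the set of all resulting $k$-tuples of outputs, one says that $T$ translates $L$ into $L'$. **Graph $\Gamma_T$.** For a $(k+1)$-tape $T\in\mathcal{T}$ translating $L$ into $L'\subseteq L^k$, $\Gamma_T$ is the labeled directed graph with vertex set $L$ and labels from $\{1,\dots,k\}$,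 in which there is an oriented edge $(u,v)$ labeled $j$ iff $T$ translates $u$ into outputs $w_1,\dots,w_k$ with $w_j=v$. **Automatic graphs.** For a finite alphabet $\Sigma$ let $\Sigma_\diamond=\Sigma\cup\{\diamond\}$, $\diamond\notin\Sigma$. The convolution $w_1\otimes\dots\otimes w_n$ of $w_1,\dots,w_n\in\Sigma^*$ is the string of length $\max_i|w_i|$ over $\Sigma_\diamond^n$ whose $p$th symbol is $(\sigma_1,\dots,\sigma_n)$, where $\sigma_i$ is the $p$th symbol of $w_i$ if $p\leqslant|w_i|$ and $\diamond$ otherwise. An $n$-tape synchronous finite automaton is a finite automaton over the alphabet $\Sigma_\diamond^n\setminus\{(\diamond,\dots,\diamond)\}$; it accepts a relation $R\subseteq(\Sigma^* )^n$ if its language is $\{w_1\otimes\dots\otimes w_n \mid (w_1,\dots,w_n)\in R\}$. A labeled directed graph $\Gamma$ in which every vertex has $k$ outgoing edges labeled by $1,\dots,k$ is automatic if there is a bijection between a regular language (over some finite alphabet) and the vertex set of $\Gamma$ such that for every $j\in\{1,\dots,k\}$ the set of oriented edges labeled by $j$ (viewed via the bijection as a binary relation on words) is accepted by a two-tape synchronous finite automaton. *)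

theory Defs
  imports Main
begin

record ('q, 's) fin_automaton =
  fa_alphabet :: "'s set"
  fa_states :: "'q set"
  fa_initial :: "'q set"
  fa_trans :: "('q \<times> 's \<times> 'q) set"
  fa_accepting :: "'q set"

definition wf_fin_automaton :: "('q, 's) fin_automaton \<Rightarrow> bool" where
  "wf_fin_automaton M \<longleftrightarrow>
     finite (fa_alphabet M) \<and> finite (fa_states M) \<and>
     fa_initial M \<subseteq> fa_states M \<and> fa_accepting M \<subseteq> fa_states M \<and>
     fa_trans M \<subseteq> fa_states M \<times> fa_alphabet M \<times> fa_states M"

fun fa_path :: "('q, 's) fin_automaton \<Rightarrow> 'q \<Rightarrow> 's list \<Rightarrow> 'q \<Rightarrow> bool" where
  "fa_path M p [] q \<longleftrightarrow> p = q"
| "fa_path M p (a # w) q \<longleftrightarrow> (\<exists>r. (p, a, r) \<in> fa_trans M \<and> fa_path M r w q)"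

definition fa_language :: "('q, 's) fin_automaton \<Rightarrow> 's list set" where
  "fa_language M =
     {w \<in> lists (fa_alphabet M). \<exists>p \<in> fa_initial M. \<exists>q \<in> fa_accepting M. fa_path M p w q}"

text \<open>States are drawn from the type \<^typ>\<open>nat\<close>; since the state set is finite, this loses
  no generality.\<close>

definition regular_language :: "'s set \<Rightarrow> 's list set \<Rightarrow> bool" where
  "regular_language A D \<longleftrightarrow>
     (\<exists>M :: (nat, 's) fin_automaton. wf_fin_automaton M \<and> fa_alphabet M = A \<and> fa_language M = D)"

text \<open>The padding symbol is \<^const>\<open>None\<close>, a proper letter \<open>a\<close> is \<open>Some a\<close>.\<close>

definition padded_nth :: "'a list \<Rightarrow> nat \<Rightarrow> 'a option" where
  "padded_nth w p = (if p < length w then Some (w ! p) else None)"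

definition convolution :: "'a list \<Rightarrow> 'a list \<Rightarrow> ('a option \<times> 'a option) list" where
  "convolution u v =
     map (\<lambda>p. (padded_nth u p, padded_nth v p)) [0..<max (length u) (length v)]"

definition padded_alphabet :: "'a set \<Rightarrow> 'a option set" where
  "padded_alphabet A = insert None (Some ` A)"

definition sync_recognizable :: "'a set \<Rightarrow> ('a list \<times> 'a list) set \<Rightarrow> bool" where
  "sync_recognizable A R \<longleftrightarrow>
     R \<subseteq> lists A \<times> lists A \<and>
     (\<exists>M :: (nat, 'a option \<times> 'a option) fin_automaton.
        wf_fin_automaton M \<and>
        fa_alphabet M = padded_alphabet A \<times> padded_alphabet A - {(None, None)} \<and>
        fa_language M = {convolution u v | u v. (u, v) \<in> R})"

text \<open>An element \<open>(u, j, v)\<close> of the second component is an oriented edge from \<open>u\<close> to \<open>v\<close>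
  labeled \<open>j\<close>.\<close>

record 'v labeled_graph =
  lg_verts :: "'v set"
  lg_edges :: "('v \<times> nat \<times> 'v) set"

definition k_labeled_graph :: "nat \<Rightarrow> 'v labeled_graph \<Rightarrow> bool" where
  "k_labeled_graph k G \<longleftrightarrow>
     lg_edges G \<subseteq> lg_verts G \<times> {1..k} \<times> lg_verts G \<and>
     (\<forall>u \<in> lg_verts G. \<forall>j \<in> {1..k}. \<exists>!v. (u, j, v) \<in> lg_edges G)"

definition labeled_graph_iso :: "'v labeled_graph \<Rightarrow> 'w labeled_graph \<Rightarrow> bool" where
  "labeled_graph_iso G H \<longleftrightarrow>
     (\<exists>f. bij_betw f (lg_verts G) (lg_verts H) \<and>
          (\<forall>u \<in> lg_verts G. \<forall>v \<in> lg_verts G. \<forall>j.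
             (u, j, v) \<in> lg_edges G \<longleftrightarrow> (f u, j, f v) \<in> lg_edges H))"

text \<open>Letters of finite alphabets are drawn from the type \<^typ>\<open>nat\<close>, again without loss of
  generality.\<close>

definition automatic_graph :: "nat \<Rightarrow> 'v labeled_graph \<Rightarrow> bool" where
  "automatic_graph k G \<longleftrightarrow>
     (\<exists>(A :: nat set) D f.
        finite A \<and> regular_language A D \<and> bij_betw f D (lg_verts G) \<and>
        (\<forall>j \<in> {1..k}.
           sync_recognizable A {(u, v). u \<in> D \<and> v \<in> D \<and> (f u, j, f v) \<in> lg_edges G}))"

datatype head_move = Move_Left | Move_Right | Stay

text \<open>Tape \<open>0\<close> is the input tape, tapes \<open>1, \<dots>, k\<close> (with \<open>k\<close> the value of \<open>tt_outputs\<close>) are the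
  output tapes. A transition reads one symbol per tape and yields the next state, the symbols
  to be written and the head moves; each of these lists has length \<open>k + 1\<close>. As in an arbitrary
  multi-tape machine, every tape (the input tape included) may be read and written.\<close>

record ('q, 'a) transducer =
  tt_outputs :: nat
  tt_states :: "'q set"
  tt_input_alphabet :: "'a set"
  tt_tape_alphabet :: "'a set"
  tt_blank :: 'a
  tt_start :: 'q
  tt_final :: "'q set"
  tt_accepting :: "'q set"
  tt_delta :: "'q \<Rightarrow> 'a list \<Rightarrow> 'q \<times> 'a list \<times> head_move list"

definition wf_transducer :: "('q, 'a) transducer \<Rightarrow> bool" where
  "wf_transducer T \<longleftrightarrow>
     tt_outputs T \<ge> 1 \<and>
     finite (tt_states T) \<and> tt_start T \<in> tt_states T \<and>
     tt_final T \<subseteq> tt_states T \<and> tt_accepting T \<subseteq> tt_final T \<and>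
     finite (tt_tape_alphabet T) \<and> tt_input_alphabet T \<subseteq> tt_tape_alphabet T \<and>
     tt_blank T \<in> tt_tape_alphabet T \<and> tt_blank T \<notin> tt_input_alphabet T \<and>
     (\<forall>q \<in> tt_states T - tt_final T. \<forall>ss \<in> lists (tt_tape_alphabet T).
        length ss = Suc (tt_outputs T) \<longrightarrow>
        (case tt_delta T q ss of (q', ws, ds) \<Rightarrow>
           q' \<in> tt_states T \<and> ws \<in> lists (tt_tape_alphabet T) \<and>
           length ws = Suc (tt_outputs T) \<and> length ds = Suc (tt_outputs T)))"

text \<open>Tapes are infinite to the right only; cell \<open>0\<close> is the leftmost cell.\<close>

record ('q, 'a) tt_config =
  cf_state :: 'q
  cf_heads :: "nat list"
  cf_tapes :: "(nat \<Rightarrow> 'a) list"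

definition word_tape :: "'a \<Rightarrow> 'a list \<Rightarrow> nat \<Rightarrow> 'a" where
  "word_tape blank w p = (if p < length w then w ! p else blank)"

definition tt_init :: "('q, 'a) transducer \<Rightarrow> 'a list \<Rightarrow> ('q, 'a) tt_config" where
  "tt_init T x =
     \<lparr>cf_state = tt_start T,
      cf_heads = replicate (Suc (tt_outputs T)) 0,
      cf_tapes = word_tape (tt_blank T) x # replicate (tt_outputs T) (\<lambda>_. tt_blank T)\<rparr>"

text \<open>A head that is told to move left from the leftmost cell remains there.\<close>

fun move_head :: "head_move \<Rightarrow> nat \<Rightarrow> nat" where
  "move_head Move_Left h = h - 1"
| "move_head Move_Right h = Suc h"
| "move_head Stay h = h"

definition tt_action ::
    "('q, 'a) transducer \<Rightarrow> ('q, 'a) tt_config \<Rightarrow> 'q \<times> 'a list \<times> head_move list" where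
  "tt_action T c =
     tt_delta T (cf_state c)
       (map (\<lambda>i. (cf_tapes c ! i) (cf_heads c ! i)) [0..<Suc (tt_outputs T)])"

definition tt_step ::
    "('q, 'a) transducer \<Rightarrow> ('q, 'a) tt_config \<Rightarrow> ('q, 'a) tt_config" where
  "tt_step T c =
     (case tt_action T c of (q', ws, ds) \<Rightarrow>
        \<lparr>cf_state = q',
         cf_heads = map (\<lambda>i. move_head (ds ! i) (cf_heads c ! i)) [0..<Suc (tt_outputs T)],
         cf_tapes = map (\<lambda>i. (cf_tapes c ! i)(cf_heads c ! i := ws ! i)) [0..<Suc (tt_outputs T)]\<rparr>)"

text \<open>Only the configurations up to the first one in a final state are meaningful; see
  \<open>halts_at\<close>.\<close>

definition tt_run :: "('q, 'a) transducer \<Rightarrow> 'a list \<Rightarrow> nat \<Rightarrow> ('q, 'a) tt_config" where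
  "tt_run T x t = (tt_step T ^^ t) (tt_init T x)"

definition halts_at :: "('q, 'a) transducer \<Rightarrow> 'a list \<Rightarrow> nat \<Rightarrow> bool" where
  "halts_at T x n \<longleftrightarrow>
     cf_state (tt_run T x n) \<in> tt_final T \<and> (\<forall>t < n. cf_state (tt_run T x t) \<notin> tt_final T)"

definition all_heads_move :: "('q, 'a) transducer \<Rightarrow> 'a list \<Rightarrow> nat \<Rightarrow> head_move \<Rightarrow> bool" where
  "all_heads_move T x t d \<longleftrightarrow>
     snd (snd (tt_action T (tt_run T x t))) = replicate (Suc (tt_outputs T)) d"

text \<open>Since \<^const>\<open>move_head\<close> allows a left move in cell \<open>0\<close>, the machine may either halt on
  arrival at the leftmost cells or still rewrite them before halting. Taking \<open>m\<close> to be the length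
  of \<open>x\<close> brings the heads to the first cell after \<open>x\<close>, where the end of the input is noticed.\<close>

definition two_sweep_run :: "('q, 'a) transducer \<Rightarrow> 'a list \<Rightarrow> nat \<Rightarrow> bool" where
  "two_sweep_run T x m \<longleftrightarrow>
     (\<exists>n \<ge> m. halts_at T x n \<and>
        (\<forall>t < m. all_heads_move T x t Move_Right) \<and>
        (\<forall>t. m \<le> t \<and> t < n \<longrightarrow> all_heads_move T x t Move_Left) \<and>
        cf_heads (tt_run T x n) = replicate (Suc (tt_outputs T)) 0)"

definition accepted_language :: "('q, 'a) transducer \<Rightarrow> 'a list set" where
  "accepted_language T =
     {x \<in> lists (tt_input_alphabet T).
        \<exists>n. halts_at T x n \<and> cf_state (tt_run T x n) \<in> tt_accepting T}"

definition translates :: "('q, 'a) transducer \<Rightarrow> 'a list \<Rightarrow> 'a list list \<Rightarrow> bool" where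
  "translates T x ys \<longleftrightarrow>
     x \<in> accepted_language T \<and>
     length ys = tt_outputs T \<and> ys \<in> lists (lists (tt_input_alphabet T)) \<and>
     (\<exists>n. halts_at T x n \<and>
        (\<forall>i < tt_outputs T. cf_tapes (tt_run T x n) ! Suc i = word_tape (tt_blank T) (ys ! i)))"

definition class_T :: "('q, 'a) transducer set" where
  "class_T =
     {T. wf_transducer T \<and>
         (\<exists>C. \<forall>x \<in> lists (tt_input_alphabet T). \<exists>e \<le> C. two_sweep_run T x (length x + e)) \<and>
         (\<forall>x \<in> accepted_language T. \<exists>ys. translates T x ys \<and> set ys \<subseteq> accepted_language T)}"

definition transducer_graph :: "('q, 'a) transducer \<Rightarrow> 'a list labeled_graph" where
  "transducer_graph T =
     \<lparr>lg_verts = accepted_language T,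
      lg_edges = {(u, j, v). j \<in> {1..tt_outputs T} \<and> (\<exists>ws. translates T u ws \<and> ws ! (j - 1) = v)}\<rparr>"

end

theory Submission
  imports Defs
begin

text \<open>
  From transducers to automata: an accepting run of \<open>T\<close> crosses each cell twice, so a
  finite automaton reading the tape from left to right can follow the right sweep and at the same time
  keep, for the prefix read so far, the set of all states in which the left sweep may enter that
  prefix from the right and then complete the run successfully. Checking the final contents of an
  output tape against a second component recognizes the edge relations, and the language of
  accepted words is already the vertex set.

  From automata to transducers: keep the regular language \<open>D\<close> of vertex names. Every edge relation is
  a function \<open>D \<rightarrow> D\<close> that lengthens words by at most a constant, for otherwise an accepting run on
  \<open>u \<otimes> v\<close> could be continued behind \<open>u\<close> in another way, giving a second image of \<open>u\<close>. The right
  sweep performs the subset construction on the first component, recording on the input tape the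
  set reached at each cell; the left sweep then selects predecessors from the
  recorded sets, which recovers an accepting run and, along with it, all output words.
\<close>

section \<open>Automata with deterministic transition functions\<close>

text \<open>Two points shape the first direction. The turn may come after the end of the input, so
  the automaton decides acceptance by what further blank letters do to its last state. In cell 0 a
  left move does not leave the cell, so many steps may be spent there; they are absorbed into the
  set of return states of cell 0 instead of being followed one by one. In the second direction,
  outputs may be longer than the input, and the left sweep can write them only if the right sweep
  has gone far enough. One constant \<open>C\<close>, larger than every excess length, lets all
  convolutions be padded to the common length |u| + C with at least one all-padding letter, so that
  the k edge automata can run in one product on the same cells. As k \<ge> 1, an accepting run of
  the product also certifies that u lies in D: accepting u and computing its outputs become one
  task. The selected run is arbitrary, but functionality makes all accepting runs on u spell the
  same outputs.\<close>

lemma finite_inj_nat: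
  assumes "finite S"
  obtains f :: "'a \<Rightarrow> nat" where "inj_on f S"
  using finite_imp_inj_to_nat_seg[OF assms] by blast

text \<open>A deterministic automaton is a fold over a finite closed set;
  \<open>regular_language\<close> fixes \<open>nat\<close> as the state type, so the states are
  renamed along an injection \<open>c\<close>.\<close>

lemma regular_language_foldl:
  fixes step :: "'q \<Rightarrow> 's \<Rightarrow> 'q"
  assumes A: "finite A" and Q: "finite Q" "q0 \<in> Q"
    and closed: "\<And>q a. q \<in> Q \<Longrightarrow> a \<in> A \<Longrightarrow> step q a \<in> Q"
  shows "regular_language A {w \<in> lists A. foldl step q0 w \<in> F}"
proof -
  obtain c :: "'q \<Rightarrow> nat" where c: "inj_on c Q"
    using finite_inj_nat[OF Q(1)] .
  define M where "M = \<lparr>fa_alphabet = A, fa_states = c ` Q, fa_initial = {c q0},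
    fa_trans = {(c q, a, c (step q a)) | q a. q \<in> Q \<and> a \<in> A}, fa_accepting = c ` (Q \<inter> F)\<rparr>"
  have foldl_Q: "foldl step q w \<in> Q" if "q \<in> Q" "w \<in> lists A" for q w
    using that by (induction w arbitrary: q) (auto simp: closed)
  have path: "fa_path M (c q) w p \<longleftrightarrow> p = c (foldl step q w)" if "q \<in> Q" "w \<in> lists A" for q w p
    using that
  proof (induction w arbitrary: q)
    case (Cons a w)
    have "(c q, a, r) \<in> fa_trans M \<longleftrightarrow> r = c (step q a)" for r
      using Cons.prems c by (auto simp: M_def inj_on_def)
    with Cons closed show ?case by simp
  qed auto
  have sel: "fa_alphabet M = A" "fa_initial M = {c q0}" "fa_accepting M = c ` (Q \<inter> F)"
    by (simp_all add: M_def)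
  have "w \<in> fa_language M \<longleftrightarrow> w \<in> lists A \<and> foldl step q0 w \<in> F" for w
  proof (cases "w \<in> lists A")
    case True
    have "(\<exists>q \<in> Q \<inter> F. c q = c (foldl step q0 w)) \<longleftrightarrow> foldl step q0 w \<in> F"
      using c foldl_Q[OF Q(2) True] by (auto simp: inj_on_def)
    with True path[OF Q(2) True] show ?thesis by (simp add: fa_language_def sel)
  qed (simp add: fa_language_def sel)
  then have "fa_language M = {w \<in> lists A. foldl step q0 w \<in> F}" by blast
  moreover have "wf_fin_automaton M"
    using A Q closed by (auto simp: wf_fin_automaton_def M_def)
  ultimately show ?thesis unfolding regular_language_def
    by (intro exI[of _ M]) (auto simp: M_def)
qed

section \<open>Configurations with all heads over the same cell\<close>

definition column :: "('q, 'a) tt_config \<Rightarrow> nat \<Rightarrow> 'a list" where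
  "column c p = map (\<lambda>tape. tape p) (cf_tapes c)"

text \<open>Heads over one common cell turn the k + 1 tapes into a single tape of columns, so that a
  step becomes one function update.\<close>

definition aligned ::
    "nat \<Rightarrow> ('q, 'a) tt_config \<Rightarrow> 'q \<Rightarrow> nat \<Rightarrow> (nat \<Rightarrow> 'a list) \<Rightarrow> bool" where
  "aligned k c q h g \<longleftrightarrow>
     cf_state c = q \<and> cf_heads c = replicate (Suc k) h \<and> length (cf_tapes c) = Suc k \<and> column c = g"

lemma aligned_action:
  assumes "aligned (tt_outputs T) c q h g"
  shows "tt_action T c = tt_delta T q (g h)"
proof -
  have "map (\<lambda>i. (cf_tapes c ! i) (cf_heads c ! i)) [0..<Suc (tt_outputs T)] = g h"
    using assms by (intro nth_equalityI) (auto simp: aligned_def column_def simp del: upt_Suc replicate_Suc)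
  with assms show ?thesis by (simp add: tt_action_def aligned_def del: upt_Suc)
qed

lemma aligned_step:
  assumes al: "aligned (tt_outputs T) c q h g"
    and delta: "tt_delta T q (g h) = (q', ws, replicate (Suc (tt_outputs T)) d)"
    and len: "length ws = Suc (tt_outputs T)"
  shows "aligned (tt_outputs T) (tt_step T c) q' (move_head d h) (g(h := ws))"
proof -
  let ?k = "Suc (tt_outputs T)"
  have act: "tt_action T c = (q', ws, replicate ?k d)"
    using aligned_action[OF al] delta by simp
  have heads: "map (\<lambda>i. move_head (replicate ?k d ! i) (cf_heads c ! i)) [0..<?k]
      = replicate ?k (move_head d h)"
    using al by (intro nth_equalityI) (auto simp: aligned_def simp del: upt_Suc replicate_Suc)
  have "column (tt_step T c) p = (g(h := ws)) p" for p
    using al len by (intro nth_equalityI)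
      (auto simp: aligned_def column_def tt_step_def act simp del: upt_Suc replicate_Suc)
  then show ?thesis using heads
    by (auto simp: aligned_def tt_step_def act simp del: upt_Suc replicate_Suc)
qed

lemma aligned_init:
  "aligned (tt_outputs T) (tt_run T x 0) (tt_start T) 0
     (\<lambda>p. word_tape (tt_blank T) x p # replicate (tt_outputs T) (tt_blank T))"
  by (auto simp: aligned_def tt_run_def tt_init_def column_def)

lemma tt_run_Suc: "tt_run T x (Suc t) = tt_step T (tt_run T x t)"
  by (simp add: tt_run_def)

lemma halts_at_unique:
  assumes "halts_at T x n" "halts_at T x n'"
  shows "n = n'"
  using assms unfolding halts_at_def by (meson linorder_neqE_nat)

lemma tape_nth_column: "i < length (cf_tapes c) \<Longrightarrow> (cf_tapes c ! i) p = column c p ! i"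
  by (simp add: column_def)

section \<open>Scanning the tape of a transducer once\<close>

text \<open>Iterated by a machine whose heads no longer move away from cell \<open>0\<close>.\<close>

definition settle :: "('q, 'a) transducer \<Rightarrow> 'q \<times> 'a list \<Rightarrow> 'q \<times> 'a list" where
  "settle T = (\<lambda>(q, c). (fst (tt_delta T q c), fst (snd (tt_delta T q c))))"

text \<open>The states in which a left sweep may enter a cell with contents \<open>c\<close>, where \<open>S\<close> is the
  corresponding set for the cell to the left; the Boolean marks cell \<open>0\<close>, which has no such neighbour
  and where the machine may still work until it halts. The letter \<open>x\<close> prescribes, via
  \<open>chk\<close>, the contents that the cell must finally have.\<close>

fun return_states ::
    "('q, 'a) transducer \<Rightarrow> ('x \<Rightarrow> 'a list \<Rightarrow> bool) \<Rightarrow> bool \<Rightarrow> 'x \<Rightarrow> 'a list \<Rightarrow> 'q set \<Rightarrow> 'q set" where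
  "return_states T chk True x c S = {r \<in> tt_states T. \<exists>j.
     fst ((settle T ^^ j) (r, c)) \<in> tt_accepting T \<and>
     (\<forall>i<j. fst ((settle T ^^ i) (r, c)) \<notin> tt_final T) \<and> chk x (snd ((settle T ^^ j) (r, c)))}"
| "return_states T chk False x c S = {r \<in> tt_states T.
     chk x (snd (settle T (r, c))) \<and> fst (settle T (r, c)) \<in> S}"

text \<open>\<open>Sweep q first S\<close>: before the turn, with \<open>q\<close> the state of the right sweep, \<open>first\<close> true in cell
  \<open>0\<close>, and \<open>S\<close> the set of return states of the previous cell. \<open>Done\<close>: behind the turn, all checks
  passed.\<close>

datatype 'q scan_state = Sweep 'q bool "'q set" | Done | Failed

text \<open>The letter alone tells what the right sweep finds, since the output cells are still
  blank. In the turning cell the left sweep starts from these contents \<open>c\<close>, in earlier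
  cells from the rewritten column \<open>ws\<close>; cells behind the turn are never visited.
  Sending successors outside \<open>tt_states T\<close> to \<open>Failed\<close> keeps the scan
  inside a finite set for arbitrary letters.\<close>

fun scan_step ::
    "('q, 'a) transducer \<Rightarrow> ('x \<Rightarrow> 'a) \<Rightarrow> ('x \<Rightarrow> 'a list \<Rightarrow> bool) \<Rightarrow> 'q scan_state \<Rightarrow> 'x \<Rightarrow> 'q scan_state"
where
  "scan_step T inp chk (Sweep q b S) x =
     (let c = inp x # replicate (tt_outputs T) (tt_blank T); (q', ws, ds) = tt_delta T q c in
      if q \<in> tt_final T \<or> ds \<noteq> replicate (Suc (tt_outputs T)) Move_Right
      then if q \<in> return_states T chk b x c S then Done else Failed
      else if q' \<in> tt_states T then Sweep q' False (return_states T chk b x ws S) else Failed)"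
| "scan_step T inp chk Done x =
     (if chk x (inp x # replicate (tt_outputs T) (tt_blank T)) then Done else Failed)"
| "scan_step T inp chk Failed x = Failed"

definition scan_init :: "('q, 'a) transducer \<Rightarrow> 'q scan_state" where
  "scan_init T = Sweep (tt_start T) True {}"

definition scan_states :: "('q, 'a) transducer \<Rightarrow> 'q scan_state set" where
  "scan_states T = {Done, Failed} \<union> {Sweep q b S | q b S. q \<in> tt_states T \<and> S \<subseteq> tt_states T}"

lemma return_states_subset: "return_states T chk b x c S \<subseteq> tt_states T"
  by (cases b) auto

lemma scan_step_closed: "s \<in> scan_states T \<Longrightarrow> scan_step T inp chk s x \<in> scan_states T"
  by (cases s) (auto simp: scan_states_def Let_def return_states_subset split: prod.split)

lemma scan_states_finite:
  assumes "wf_transducer T"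
  shows "finite (scan_states T)"
proof -
  have "scan_states T = {Done, Failed} \<union>
      (\<lambda>(q, b, S). Sweep q b S) ` (tt_states T \<times> UNIV \<times> Pow (tt_states T))"
    unfolding scan_states_def by (auto simp: image_iff Bex_def)
  with assms show ?thesis by (simp add: wf_transducer_def)
qed

lemma scan_init_state: "wf_transducer T \<Longrightarrow> scan_init T \<in> scan_states T"
  by (auto simp: scan_states_def scan_init_def wf_transducer_def)

lemma wf_transducer_delta:
  assumes "wf_transducer T" "q \<in> tt_states T" "q \<notin> tt_final T"
    and "c \<in> lists (tt_tape_alphabet T)" "length c = Suc (tt_outputs T)"
  obtains q' ws ds where "tt_delta T q c = (q', ws, ds)" "q' \<in> tt_states T"
    "ws \<in> lists (tt_tape_alphabet T)" "length ws = Suc (tt_outputs T)"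
proof -
  obtain q' ws ds where d: "tt_delta T q c = (q', ws, ds)" by (metis prod_cases3)
  have "\<forall>q \<in> tt_states T - tt_final T. \<forall>ss \<in> lists (tt_tape_alphabet T).
        length ss = Suc (tt_outputs T) \<longrightarrow>
        (case tt_delta T q ss of (q', ws, ds) \<Rightarrow>
           q' \<in> tt_states T \<and> ws \<in> lists (tt_tape_alphabet T) \<and>
           length ws = Suc (tt_outputs T) \<and> length ds = Suc (tt_outputs T))"
    using assms(1) unfolding wf_transducer_def by (elim conjE)
  from bspec[OF bspec[OF this DiffI[OF assms(2,3)]] assms(4)] assms(5) d that
  show thesis by simp
qed

text \<open>The letters form an infinite sequence \<open>X\<close>, because the turn may lie behind
  the word that an automaton reads. Leaving \<open>chk\<close> open lets the same analysis serve the
  accepted language and the edge relations.\<close>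

locale two_sweeps =
  fixes T :: "('q, 'a) transducer" and u :: "'a list" and m n :: nat
    and inp :: "'x \<Rightarrow> 'a" and chk :: "'x \<Rightarrow> 'a list \<Rightarrow> bool" and X :: "nat \<Rightarrow> 'x"
  assumes wf: "wf_transducer T" and u: "u \<in> lists (tt_input_alphabet T)"
    and m_n: "m \<le> n" and halts: "halts_at T u n"
    and right: "t < m \<Longrightarrow> all_heads_move T u t Move_Right"
    and left: "m \<le> t \<Longrightarrow> t < n \<Longrightarrow> all_heads_move T u t Move_Left"
    and home: "cf_heads (tt_run T u n) = replicate (Suc (tt_outputs T)) 0"
    and inp: "inp (X p) = word_tape (tt_blank T) u p"
begin

section \<open>The two sweeps of a single run, cell by cell\<close>

abbreviation "k \<equiv> tt_outputs T"
abbreviation "run t \<equiv> tt_run T u t"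
abbreviation "state t \<equiv> cf_state (run t)"

definition good_column :: "'a list \<Rightarrow> bool" where
  "good_column c \<longleftrightarrow> c \<in> lists (tt_tape_alphabet T) \<and> length c = Suc k"

definition input_column :: "nat \<Rightarrow> 'a list" where
  "input_column p = inp (X p) # replicate k (tt_blank T)"

text \<open>The contents that the left sweep finds in cell \<open>p\<close>.\<close>

definition middle_column :: "nat \<Rightarrow> 'a list" where
  "middle_column p = (if p < m then fst (snd (tt_action T (run p))) else input_column p)"

lemma input_column_good: "good_column (input_column p)"
proof -
  have "word_tape (tt_blank T) u p \<in> tt_tape_alphabet T"
    using wf u by (auto simp: wf_transducer_def word_tape_def in_lists_conv_set)
  with wf show ?thesis by (auto simp: good_column_def input_column_def inp wf_transducer_def)
qed

lemma not_final: "t < n \<Longrightarrow> state t \<notin> tt_final T"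
  using halts by (simp add: halts_at_def)

text \<open>\<open>settle\<close> describes the new state and column whatever the direction, so one
  lemma serves both sweeps and the stay in cell 0; only \<open>d\<close> depends on the
  time.\<close>

lemma step_aligned:
  assumes al: "aligned k (run t) (state t) h g" and q: "state t \<in> tt_states T"
    and g: "\<And>p. good_column (g p)" and t: "t < n"
    and d: "d = (if t < m then Move_Right else Move_Left)"
  defines "ws \<equiv> snd (settle T (state t, g h))"
  shows "aligned k (run (Suc t)) (state (Suc t)) (move_head d h) (g(h := ws))"
    and "state (Suc t) = fst (settle T (state t, g h))"
    and "state (Suc t) \<in> tt_states T" and "good_column ((g(h := ws)) p)"
    and "tt_delta T (state t) (g h) = (state (Suc t), ws, replicate (Suc k) d)"
    and "tt_action T (run t) = (state (Suc t), ws, replicate (Suc k) d)"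
proof -
  obtain q' ws' ds where delta: "tt_delta T (state t) (g h) = (q', ws', ds)" "q' \<in> tt_states T"
      "good_column ws'"
    using wf_transducer_delta[OF wf q not_final[OF t]] g unfolding good_column_def by metis
  have act: "tt_action T (run t) = (q', ws', ds)"
    using aligned_action[OF al] delta(1) by simp
  have ds: "ds = replicate (Suc k) d"
    using right[of t] left[of t] t d act by (cases "t < m") (auto simp: all_heads_move_def)
  have ws: "ws = ws'" by (simp add: ws_def settle_def delta(1))
  have "aligned k (run (Suc t)) q' (move_head d h) (g(h := ws))"
    using aligned_step[OF al] delta ds ws by (simp add: tt_run_Suc good_column_def)
  moreover from this have "state (Suc t) = q'" by (simp add: aligned_def)
  ultimately show "aligned k (run (Suc t)) (state (Suc t)) (move_head d h) (g(h := ws))"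
    "state (Suc t) = fst (settle T (state t, g h))"
    "state (Suc t) \<in> tt_states T" "good_column ((g(h := ws)) p)"
    "tt_delta T (state t) (g h) = (state (Suc t), ws, replicate (Suc k) d)"
    "tt_action T (run t) = (state (Suc t), ws, replicate (Suc k) d)"
    using delta ds ws g act by (auto simp: settle_def)
qed

text \<open>On the way right, time and cell coincide. Membership in the state set and the tape
  alphabet is carried along because \<open>wf_transducer\<close> controls \<open>tt_delta\<close>
  only there.\<close>

lemma right_sweep:
  "t \<le> m \<Longrightarrow> aligned k (run t) (state t) t (\<lambda>p. if p < t then middle_column p else input_column p) \<and>
     state t \<in> tt_states T \<and> (\<forall>p < t. good_column (middle_column p))"
proof (induction t)
  case 0
  have "aligned k (run 0) (tt_start T) 0 input_column"
    using aligned_init[of T u] by (simp add: input_column_def[abs_def] inp)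
  moreover have "tt_start T \<in> tt_states T" using wf by (simp add: wf_transducer_def)
  ultimately show ?case by (auto simp: aligned_def)
next
  case (Suc t)
  let ?g = "\<lambda>p. if p < t then middle_column p else input_column p"
  have al: "aligned k (run t) (state t) t ?g" and q: "state t \<in> tt_states T"
    and good: "\<forall>p<t. good_column (middle_column p)" using Suc by auto
  have g: "good_column (?g p)" for p using good input_column_good by simp
  have t: "t < n" "t < m" using Suc.prems m_n by auto
  have d: "Move_Right = (if t < m then Move_Right else Move_Left)" using t by simp
  note st = step_aligned[OF al q g t(1) d]
  have mid: "middle_column t = snd (settle T (state t, ?g t))"
    using st(6) t by (simp add: middle_column_def)
  have "?g(t := middle_column t) = (\<lambda>p. if p < Suc t then middle_column p else input_column p)"
    by (auto simp: less_Suc_eq)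
  with st(1,3) st(4)[of t] mid good show ?case by (auto simp: less_Suc_eq)
qed

lemma middle_column_good: "good_column (middle_column p)"
  using right_sweep[of m] input_column_good by (cases "p < m") (auto simp: middle_column_def)

lemma right_step:
  assumes "t < m"
  shows "tt_delta T (state t) (input_column t) = (state (Suc t), middle_column t, replicate (Suc k) Move_Right)"
proof -
  let ?g = "\<lambda>p. if p < t then middle_column p else input_column p"
  have al: "aligned k (run t) (state t) t ?g" "state t \<in> tt_states T"
    using right_sweep[of t] assms by auto
  have good: "good_column (?g p)" for p
    using middle_column_good input_column_good by simp
  have t: "t < n" "Move_Right = (if t < m then Move_Right else Move_Left)"
    using assms m_n by auto
  note st = step_aligned[OF al good t]
  have "middle_column t = snd (settle T (state t, ?g t))"
    using st(6) assms by (simp add: middle_column_def)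
  with st(5) show ?thesis by simp
qed

text \<open>At time \<open>m\<close> the run has halted or moves left, so the turn shows in the
  transition and the scan can recognize it.\<close>

lemma turn_step:
  "state m \<in> tt_final T \<or> snd (snd (tt_delta T (state m) (input_column m))) \<noteq> replicate (Suc k) Move_Right"
proof (cases "m < n")
  case True
  let ?g = "\<lambda>p. if p < m then middle_column p else input_column p"
  have al: "aligned k (run m) (state m) m ?g" "state m \<in> tt_states T"
    using right_sweep[of m] by auto
  have good: "good_column (?g p)" for p
    using middle_column_good input_column_good by simp
  have d: "Move_Left = (if m < m then Move_Right else Move_Left)" by simp
  show ?thesis using step_aligned(5)[OF al good True d] by simp
next
  case False
  then show ?thesis using m_n halts by (simp add: halts_at_def)
qed

text \<open>The columns left of the head, under it and behind cell \<open>m\<close> are still those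
  of the turn. The cells passed since then are left open here and treated in
  \<open>returning_success\<close>.\<close>

lemma left_sweep:
  assumes "s \<le> m"
  shows "m + s \<le> n \<and> state (m + s) \<in> tt_states T \<and> (\<exists>g. aligned k (run (m + s)) (state (m + s)) (m - s) g \<and>
     (\<forall>p. good_column (g p)) \<and> (\<forall>p. p \<le> m - s \<or> m < p \<longrightarrow> g p = middle_column p))"
  using assms
proof (induction s)
  case 0
  have "(\<lambda>p. if p < m then middle_column p else input_column p) = middle_column"
    by (auto simp: middle_column_def)
  with right_sweep[of m] m_n middle_column_good show ?case by auto
next
  case (Suc s)
  then obtain g where le: "m + s \<le> n" and q: "state (m + s) \<in> tt_states T"
    and al: "aligned k (run (m + s)) (state (m + s)) (m - s) g"
    and good: "\<And>p. good_column (g p)" and g: "\<And>p. p \<le> m - s \<or> m < p \<Longrightarrow> g p = middle_column p" by auto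
  \<comment> \<open>Halting now would leave the heads over cell \<open>m - s\<close>, which is
    positive.\<close>
  have "m + s \<noteq> n" using al home Suc.prems by (auto simp: aligned_def)
  with le have lt: "m + s < n" by simp
  have d: "Move_Left = (if m + s < m then Move_Right else Move_Left)" by simp
  note st = step_aligned[OF al q good lt d]
  have "aligned k (run (m + Suc s)) (state (m + Suc s)) (m - Suc s)
      (g(m - s := snd (settle T (state (m + s), g (m - s)))))" using st(1) by simp
  moreover have "\<forall>p. p \<le> m - Suc s \<or> m < p \<longrightarrow> (g(m - s := ws)) p = middle_column p" for ws
  proof -
    have "p \<noteq> m - s \<and> (p \<le> m - s \<or> m < p)" if "p \<le> m - Suc s \<or> m < p" for p
      using that Suc.prems by arith
    with g show ?thesis by simp
  qed
  ultimately show ?case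
    using st(3,4) lt by (metis Suc_leI add_Suc_right)
qed

text \<open>The left sweep enters cell 0 at time 2m, and \<open>move_head\<close> keeps the heads
  there: whatever follows rewrites column 0 only, by iterating \<open>settle\<close>.\<close>

lemma settling:
  assumes "aligned k (run (2 * m)) (state (2 * m)) 0 g" "state (2 * m) \<in> tt_states T" "\<And>p. good_column (g p)"
  defines "z j \<equiv> (settle T ^^ j) (state (2 * m), g 0)"
  shows "2 * m + j \<le> n \<Longrightarrow> aligned k (run (2 * m + j)) (state (2 * m + j)) 0 (g(0 := snd (z j))) \<and>
    state (2 * m + j) = fst (z j) \<and> fst (z j) \<in> tt_states T \<and> good_column (snd (z j))"
proof (induction j)
  case 0
  then show ?case using assms by (auto simp: z_def)
next
  case (Suc j)
  then have "2 * m + j \<le> n" by simp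
  note IH = Suc.IH[OF this]
  have al: "aligned k (run (2 * m + j)) (state (2 * m + j)) 0 (g(0 := snd (z j)))"
    using IH by (elim conjE)
  have q: "state (2 * m + j) = fst (z j)" "state (2 * m + j) \<in> tt_states T"
    and c: "good_column (snd (z j))" using IH by (simp_all only:)
  have good: "good_column ((g(0 := snd (z j))) p)" for p using c assms(3) by simp
  have lt: "2 * m + j < n" using Suc.prems by simp
  have d: "Move_Left = (if 2 * m + j < m then Move_Right else Move_Left)" by simp
  note st = step_aligned[OF al q(2) good lt d]
  have "z (Suc j) = settle T (z j)" by (simp add: z_def)
  then show ?case using st(1,2,3) st(4)[of 0] q(1) by (simp del: fun_upd_apply add: fun_upd_same)
qed

text \<open>Reindexing by cells: \<open>m\<close> steps out and \<open>m - p\<close> steps back lead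
  to cell \<open>p\<close>.\<close>

lemma left_sweep_at:
  assumes "p \<le> m"
  shows "2 * m - p \<le> n" and "state (2 * m - p) \<in> tt_states T"
    and "\<exists>g. aligned k (run (2 * m - p)) (state (2 * m - p)) p g \<and>
     (\<forall>i. good_column (g i)) \<and> (\<forall>i. i \<le> p \<or> m < i \<longrightarrow> g i = middle_column i)"
proof -
  have "m + (m - p) = 2 * m - p" "m - (m - p) = p" using assms by auto
  with left_sweep[of "m - p"] show "2 * m - p \<le> n" "state (2 * m - p) \<in> tt_states T"
    "\<exists>g. aligned k (run (2 * m - p)) (state (2 * m - p)) p g \<and>
     (\<forall>i. good_column (g i)) \<and> (\<forall>i. i \<le> p \<or> m < i \<longrightarrow> g i = middle_column i)"
    by simp_all
qed

lemma settled:
  assumes "aligned k (run (2 * m)) (state (2 * m)) 0 g" "\<And>i. good_column (g i)" "0 < i"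
  shows "column (run n) i = g i"
  using settling[OF assms(1) _ assms(2), of "n - 2 * m"] left_sweep_at(1,2)[of 0] assms(3)
  by (simp add: aligned_def)

section \<open>Return states and the verdict of the scan\<close>

primrec returning :: "nat \<Rightarrow> 'q set" where
  "returning 0 = return_states T chk True (X 0) (middle_column 0) {}"
| "returning (Suc p) = return_states T chk False (X (Suc p)) (middle_column (Suc p)) (returning p)"

text \<open>Only \<open>N\<close> cells are checked because an automaton has read only
  \<open>N\<close> letters.\<close>

definition success :: "nat \<Rightarrow> bool" where
  "success N \<longleftrightarrow> state n \<in> tt_accepting T \<and> (\<forall>p < N. chk (X p) (column (run n) p))"

text \<open>At time 2m - p the cells behind \<open>p\<close> have their final contents, so their
  checks can be read off the current configuration, while \<open>returning p\<close> accounts for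
  the rest of the run on the cells 0 to p. The induction goes backwards in time, from the arrival in
  cell 0. Only states that the run really takes are compared, so \<open>return_states\<close> can
  leave the head moves to the locale.\<close>

lemma returning_success:
  assumes "p \<le> m" "m < N"
  shows "state (2 * m - p) \<in> returning p \<and>
      (\<forall>i \<in> {p<..<N}. chk (X i) (column (run (2 * m - p)) i)) \<longleftrightarrow> success N"
  using assms(1)
proof (induction p)
  case 0
  have le: "2 * m \<le> n" and q: "state (2 * m) \<in> tt_states T"
    using left_sweep_at(1,2)[of 0] by auto
  obtain g where al: "aligned k (run (2 * m)) (state (2 * m)) 0 g"
    and good: "\<And>p. good_column (g p)" and g: "g 0 = middle_column 0"
    using left_sweep_at(3)[of 0] by auto
  define z where "z j = (settle T ^^ j) (state (2 * m), g 0)" for j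
  note set = settling[OF al q good, folded z_def]
  define J where "J = n - 2 * m"
  have n: "n = 2 * m + J" using le by (simp add: J_def)
  have acc: "tt_accepting T \<subseteq> tt_final T" using wf by (simp add: wf_transducer_def)
  have fin: "fst (z i) \<notin> tt_final T" if "i < J" for i
    using set[of i] not_final[of "2 * m + i"] that n by simp
  have finJ: "fst (z J) \<in> tt_final T" using set[of J] halts n by (simp add: halts_at_def)
  \<comment> \<open>The condition on earlier indices forces \<open>j\<close> to be the first final
    index, which is \<open>J\<close>, the number of steps the run spends in cell 0.\<close>
  have "(\<exists>j. fst (z j) \<in> tt_accepting T \<and> (\<forall>i<j. fst (z i) \<notin> tt_final T) \<and> chk (X 0) (snd (z j)))
      \<longleftrightarrow> fst (z J) \<in> tt_accepting T \<and> chk (X 0) (snd (z J))" (is "(\<exists>j. ?P j) \<longleftrightarrow> _")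
  proof
    assume "\<exists>j. ?P j"
    then obtain j where j: "?P j" by blast
    with fin finJ acc have "j = J" by (metis linorder_neqE_nat subsetD)
    with j show "fst (z J) \<in> tt_accepting T \<and> chk (X 0) (snd (z J))" by simp
  qed (use fin in blast)
  then have "state (2 * m) \<in> returning 0 \<longleftrightarrow> state n \<in> tt_accepting T \<and> chk (X 0) (column (run n) 0)"
    using q set[of J] n by (simp add: g[symmetric] z_def[symmetric] aligned_def)
  moreover have "column (run n) i = column (run (2 * m)) i" if "i > 0" for i
    using settled[OF al good] al that by (simp add: aligned_def)
  moreover have "(\<forall>i<N. P i) \<longleftrightarrow> P 0 \<and> (\<forall>i \<in> {0<..<N}. P i)" for P
    using assms(2) by (metis gr0I greaterThanLessThan_iff less_nat_zero_code)
  ultimately show ?case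
    using assms(2) unfolding success_def by auto
next
  case (Suc p)
  define t where "t = 2 * m - Suc p"
  have St: "Suc t = 2 * m - p" and mt: "m \<le> t" using Suc.prems by (auto simp: t_def)
  have q: "state t \<in> tt_states T" using left_sweep_at(2)[OF Suc.prems] by (simp add: t_def)
  obtain g where al: "aligned k (run t) (state t) (Suc p) g"
    and good: "\<And>i. good_column (g i)" and g: "g (Suc p) = middle_column (Suc p)"
    using left_sweep_at(3)[OF Suc.prems] unfolding t_def by auto
  have lt: "t < n" using left_sweep_at(1)[of p] Suc.prems St by simp
  have d: "Move_Left = (if t < m then Move_Right else Move_Left)" using mt by simp
  note st = step_aligned[OF al q good lt d]
  let ?ws = "snd (settle T (state t, g (Suc p)))"
  have col: "column (run t) = g" "column (run (Suc t)) = g(Suc p := ?ws)"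
    using al st(1) mt by (simp_all add: aligned_def)
  have "state t \<in> returning (Suc p) \<longleftrightarrow> chk (X (Suc p)) ?ws \<and> state (Suc t) \<in> returning p"
    using q st(2) mt g by auto
  \<comment> \<open>The left step fixes column \<open>Suc p\<close> for good, so its check passes
    from the return set to the configuration.\<close>
  moreover have "(\<forall>i \<in> {p<..<N}. chk (X i) (column (run (Suc t)) i)) \<longleftrightarrow>
      chk (X (Suc p)) ?ws \<and> (\<forall>i \<in> {Suc p<..<N}. chk (X i) (column (run t) i))"
    unfolding col using assms(2) Suc.prems by (auto simp: Suc_le_eq)
  ultimately show ?case using Suc.IH Suc.prems unfolding St[symmetric] t_def[symmetric] by auto
qed

abbreviation "scan N \<equiv> foldl (scan_step T inp chk) (scan_init T) (map X [0..<N])"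

lemma returning_eq:
  "returning p = return_states T chk (p = 0) (X p) (middle_column p) (case p of 0 \<Rightarrow> {} | Suc i \<Rightarrow> returning i)"
  by (cases p) (simp_all del: return_states.simps)

lemma scan_right:
  "p \<le> m \<Longrightarrow> scan p = Sweep (state p) (p = 0) (case p of 0 \<Rightarrow> {} | Suc i \<Rightarrow> returning i)"
proof (induction p)
  case 0
  then show ?case using aligned_init[of T u] by (simp add: scan_init_def aligned_def)
next
  case (Suc p)
  have "state p \<notin> tt_final T" using not_final Suc.prems m_n by simp
  moreover have "state (Suc p) \<in> tt_states T" using right_sweep[of "Suc p"] Suc.prems by simp
  ultimately show ?case using Suc right_step[of p] returning_eq[of p]
    by (simp add: input_column_def[symmetric] del: return_states.simps returning.simps)
qed

lemma scan_done: "m < N \<Longrightarrow> scan N = Done \<longleftrightarrow> success N"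
proof -
  have turn: "scan (Suc m) = (if state m \<in> returning m then Done else Failed)"
  proof -
    \<comment> \<open>The right sweep does not write the turning cell, so the column computed by the
      scan is the one from which the left sweep starts.\<close>
    have "middle_column m = input_column m" by (simp add: middle_column_def)
    then have "return_states T chk (m = 0) (X m) (input_column m)
       (case m of 0 \<Rightarrow> {} | Suc i \<Rightarrow> returning i) = returning m"
      using returning_eq[of m] by simp
    with scan_right[of m] turn_step show ?thesis
      by (auto simp: input_column_def[symmetric] Let_def
          simp del: return_states.simps returning.simps split: prod.split)
  qed
  have col: "column (run m) i = input_column i" if "m < i" for i
    using right_sweep[of m] that by (simp add: aligned_def)
  have "scan (Suc m + j) = (if state m \<in> returning m \<and> (\<forall>i \<in> {m<..<Suc m + j}. chk (X i) (input_column i))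
      then Done else Failed)" for j
  proof (induction j)
    case 0
    show ?case using turn by auto
  next
    case (Suc j)
    have "{m<..<Suc m + Suc j} = insert (Suc m + j) {m<..<Suc m + j}" by auto
    with Suc show ?case by (auto simp: input_column_def)
  qed
  from this[of "N - Suc m"] show "scan N = Done \<longleftrightarrow> success N" if "m < N"
    using returning_success[of m N] that col by (auto split: if_splits)
qed

lemma scan_not_done: "N \<le> m \<Longrightarrow> scan N \<noteq> Done"
  using scan_right[of N] by simp

lemma column_outside: "m < p \<Longrightarrow> column (run n) p = input_column p"
proof -
  assume "m < p"
  moreover obtain g where "aligned k (run (2 * m)) (state (2 * m)) 0 g" "\<And>i. good_column (g i)"
    "\<And>i. m < i \<Longrightarrow> g i = middle_column i"
    using left_sweep_at(3)[of 0] by auto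
  ultimately show ?thesis using settled[of g p] by (simp add: middle_column_def)
qed

text \<open>Behind both the turn and the first \<open>N\<close> letters every column is blank and
  passes the check for \<open>pad\<close>, so finitely many checks decide all of them;
  \<open>Suc m\<close> extra letters always reach beyond the turn.\<close>

lemma scan_eventually_done:
  assumes pad: "\<And>p. N \<le> p \<Longrightarrow> X p = pad"
    and chk: "chk pad (replicate (Suc k) (tt_blank T))"
  shows "(\<exists>i. scan (N + i) = Done) \<longleftrightarrow>
    state n \<in> tt_accepting T \<and> (\<forall>p. chk (X p) (column (run n) p))" (is "?L \<longleftrightarrow> ?R")
proof
  assume ?L
  then obtain i where i: "scan (N + i) = Done" by blast
  then have m: "m < N + i" using scan_not_done by (meson not_less)
  with i have ok: "success (N + i)" using scan_done by blast
  have "chk (X p) (column (run n) p)" for p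
  proof (cases "p < N + i")
    case True
    with ok show ?thesis by (simp add: success_def)
  next
    case False
    \<comment> \<open>Position \<open>N + length u\<close> lies behind the word and carries
      \<open>pad\<close>, so \<open>pad\<close> must read as a blank.\<close>
    have "inp pad = tt_blank T"
      using inp[of "N + length u"] pad[of "N + length u"] by (simp add: word_tape_def)
    with False show ?thesis using column_outside[of p] m pad[of p] chk
      by (simp add: input_column_def)
  qed
  with ok show ?R by (simp add: success_def)
next
  assume ?R
  then have "success (N + Suc m)" by (simp add: success_def)
  then show ?L using scan_done[of "N + Suc m"] by (intro exI[of _ "Suc m"]) simp
qed

end

section \<open>Transducer graphs are automatic\<close>

lemma length_tapes: "length (cf_tapes (tt_run T x t)) = Suc (tt_outputs T)"
  by (cases t) (simp_all add: tt_run_def tt_init_def tt_step_def case_prod_beta del: upt_Suc)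

lemma class_T_wf: "T \<in> class_T \<Longrightarrow> wf_transducer T"
  by (simp add: class_T_def)

lemma class_T_translates:
  assumes "T \<in> class_T" "u \<in> accepted_language T"
  obtains ys where "translates T u ys" "set ys \<subseteq> accepted_language T"
proof -
  have "\<forall>x \<in> accepted_language T. \<exists>ys. translates T x ys \<and> set ys \<subseteq> accepted_language T"
    using assms(1) unfolding class_T_def by simp
  with assms(2) that show thesis by blast
qed

lemma translatesD:
  assumes "translates T u ys"
  shows "u \<in> accepted_language T" "u \<in> lists (tt_input_alphabet T)" "length ys = tt_outputs T"
    and "\<exists>n. halts_at T u n \<and>
      (\<forall>i < tt_outputs T. cf_tapes (tt_run T u n) ! Suc i = word_tape (tt_blank T) (ys ! i))"
    and "i < tt_outputs T \<Longrightarrow> ys ! i \<in> lists (tt_input_alphabet T)"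
proof -
  show "ys ! i \<in> lists (tt_input_alphabet T)" if "i < tt_outputs T"
  proof -
    have "ys ! i \<in> set ys" using assms that by (simp add: translates_def)
    moreover have "ys \<in> lists (lists (tt_input_alphabet T))" using assms by (simp only: translates_def)
    ultimately show ?thesis by (rule in_listsD[THEN bspec, rotated])
  qed
qed (use assms in \<open>simp_all add: translates_def accepted_language_def\<close>)

lemma finite_input_alphabet: "T \<in> class_T \<Longrightarrow> finite (tt_input_alphabet T)"
  using finite_subset[of "tt_input_alphabet T" "tt_tape_alphabet T"]
  by (simp add: class_T_def wf_transducer_def)

lemma class_T_two_sweeps:
  assumes "T \<in> class_T" "u \<in> lists (tt_input_alphabet T)"
    and "\<And>p. inp (X p) = word_tape (tt_blank T) u p"
  obtains m n where "two_sweeps T u m n inp X"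
proof -
  obtain m where "two_sweep_run T u m" using assms(1,2) unfolding class_T_def by blast
  then obtain n where "n \<ge> m" "halts_at T u n" "\<forall>t < m. all_heads_move T u t Move_Right"
    "\<forall>t. m \<le> t \<and> t < n \<longrightarrow> all_heads_move T u t Move_Left"
    "cf_heads (tt_run T u n) = replicate (Suc (tt_outputs T)) 0"
    unfolding two_sweep_run_def by blast
  then have "two_sweeps T u m n inp X" using assms class_T_wf[OF assms(1)]
    by (intro two_sweeps.intro) simp_all
  with that show thesis .
qed

text \<open>The turn may lie behind the end of the word, so final states are those from which the
  remaining blank cells lead to \<open>Done\<close>.\<close>

definition scan_final ::
    "('q, 'a) transducer \<Rightarrow> ('x \<Rightarrow> 'a) \<Rightarrow> ('x \<Rightarrow> 'a list \<Rightarrow> bool) \<Rightarrow> 'x \<Rightarrow> 'q scan_state set" where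
  "scan_final T inp chk pad = {s. \<exists>i. foldl (scan_step T inp chk) s (replicate i pad) = Done}"

definition pad_nth :: "'x \<Rightarrow> 'x list \<Rightarrow> nat \<Rightarrow> 'x" where
  "pad_nth pad w p = (if p < length w then w ! p else pad)"

lemma map_pad_nth: "map (pad_nth pad w) [0..<length w + i] = w @ replicate i pad"
  by (intro nth_equalityI) (auto simp: pad_nth_def nth_append)

lemma scan_word:
  assumes "T \<in> class_T" "u \<in> lists (tt_input_alphabet T)"
    and inp: "\<And>p. inp (pad_nth pad w p) = word_tape (tt_blank T) u p"
    and chk: "chk pad (replicate (Suc (tt_outputs T)) (tt_blank T))"
  shows "foldl (scan_step T inp chk) (scan_init T) w \<in> scan_final T inp chk pad \<longleftrightarrow>
    (\<exists>n. halts_at T u n \<and> cf_state (tt_run T u n) \<in> tt_accepting T \<and>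
      (\<forall>p. chk (pad_nth pad w p) (column (tt_run T u n) p)))"
proof -
  obtain m n where "two_sweeps T u m n inp (pad_nth pad w)"
    using class_T_two_sweeps[OF assms(1,2), of inp "pad_nth pad w"] inp by blast
  then interpret two_sweeps T u m n inp chk "pad_nth pad w" .
  have "foldl (scan_step T inp chk) (scan_init T) w \<in> scan_final T inp chk pad \<longleftrightarrow>
      (\<exists>i. scan (length w + i) = Done)"
    by (simp only: scan_final_def mem_Collect_eq map_pad_nth foldl_append)
  also have "\<dots> \<longleftrightarrow> state n \<in> tt_accepting T \<and> (\<forall>p. chk (pad_nth pad w p) (column (run n) p))"
    using chk by (intro scan_eventually_done) (simp_all add: pad_nth_def)
  also have "\<dots> \<longleftrightarrow> (\<exists>n. halts_at T u n \<and> state n \<in> tt_accepting T \<and>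
      (\<forall>p. chk (pad_nth pad w p) (column (run n) p)))"
    using halts halts_at_unique by blast
  finally show ?thesis .
qed

lemma regular_accepted_language:
  assumes T: "T \<in> class_T"
  shows "regular_language (tt_input_alphabet T) (accepted_language T)"
proof -
  let ?step = "scan_step T (\<lambda>a. a) (\<lambda>_ _. True)"
  note wf = class_T_wf[OF T] and fin = finite_input_alphabet[OF T]
  have "regular_language (tt_input_alphabet T) {w \<in> lists (tt_input_alphabet T).
      foldl ?step (scan_init T) w \<in> scan_final T (\<lambda>a. a) (\<lambda>_ _. True) (tt_blank T)}"
    by (intro regular_language_foldl[where Q = "scan_states T"] fin scan_states_finite[OF wf]
        scan_init_state[OF wf] scan_step_closed)
  also have "{w \<in> lists (tt_input_alphabet T).
      foldl ?step (scan_init T) w \<in> scan_final T (\<lambda>a. a) (\<lambda>_ _. True) (tt_blank T)} = accepted_language T"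
    using scan_word[OF T, of _ "\<lambda>a. a" "tt_blank T" _ "\<lambda>_ _. True"]
    by (auto simp: accepted_language_def pad_nth_def word_tape_def)
  finally show ?thesis .
qed

text \<open>The first track of a convolution must be a word followed by padding. The second track
  gets its shape from the comparison with an output tape, which holds a word.\<close>

definition pad_check :: "bool \<times> bool \<Rightarrow> 'a option \<Rightarrow> bool \<times> bool" where
  "pad_check = (\<lambda>(ended, ok) a. (a = None, ok \<and> (ended \<longrightarrow> a = None)))"

lemma foldl_pad_check:
  "foldl pad_check (False, True) l =
     (l \<noteq> [] \<and> last l = None, \<exists>u i. l = map Some u @ replicate i None)"
proof (induction l rule: rev_induct)
  case (snoc a l)
  have "(\<exists>u i. l @ [a] = map Some u @ replicate i None) \<longleftrightarrow>
      (\<exists>u i. l = map Some u @ replicate i None) \<and> (l \<noteq> [] \<and> last l = None \<longrightarrow> a = None)" (is "?L \<longleftrightarrow> ?R")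
  proof
    assume ?L
    then obtain u i where eq: "l @ [a] = map Some u @ replicate i None" by blast
    show ?R
    proof (cases i)
      case 0
      with eq obtain u' x where "u = u' @ [x]" by (cases u rule: rev_cases) auto
      with eq 0 have "l = map Some u'" "a = Some x" by auto
      then show ?thesis by (metis append_Nil2 last_map map_is_Nil_conv option.distinct(1) replicate_0)
    next
      case (Suc i')
      with eq have "l @ [a] = (map Some u @ replicate i' None) @ [None]"
        by (simp add: replicate_append_same)
      then show ?thesis by blast
    qed
  next
    assume R: ?R
    then obtain u i where l: "l = map Some u @ replicate i None" by blast
    show ?L
    proof (cases a)
      case None
      then have "l @ [a] = map Some u @ replicate (Suc i) None" using l by (simp add: replicate_append_same)
      then show ?thesis by blast
    next
      case (Some x)
      have "l \<noteq> [] \<and> last l = None" if "i \<noteq> 0" using l that by simp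
      with R Some have "i = 0" by blast
      with l Some have "l @ [a] = map Some (u @ [x]) @ replicate 0 None" by simp
      then show ?thesis by blast
    qed
  qed
  with snoc show ?case by (simp add: pad_check_def)
qed simp

section \<open>Convolutions as padded sequences, and recognition of the edge relations\<close>

lemma map_fst_padded:
  "map fst w = map Some u @ replicate i None \<Longrightarrow> fst (pad_nth (None, None) w p) = padded_nth u p"
proof -
  assume eq: "map fst w = map Some u @ replicate i None"
  then have len: "length w = length u + i" by (metis length_append length_map length_replicate)
  have "fst (w ! p) = (map Some u @ replicate i None) ! p" if "p < length w"
    using that by (simp flip: eq)
  with len show ?thesis by (auto simp: pad_nth_def padded_nth_def nth_append)
qed

lemma pad_nth_convolution: "pad_nth (None, None) (convolution u v) p = (padded_nth u p, padded_nth v p)"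
  by (auto simp: pad_nth_def padded_nth_def convolution_def)

text \<open>Without \<open>(None, None)\<close> among its letters, the length of \<open>w\<close> is
  visible in its padded continuation.\<close>

lemma convolutionI:
  assumes "(None, None) \<notin> set w" "\<And>p. pad_nth (None, None) w p = (padded_nth u p, padded_nth v p)"
  shows "w = convolution u v"
proof -
  have "p < length w \<longleftrightarrow> p < length (convolution u v)" for p
  proof -
    have "p < length w \<longleftrightarrow> pad_nth (None, None) w p \<noteq> (None, None)"
      using assms(1) by (auto simp: pad_nth_def in_set_conv_nth)
    also have "\<dots> \<longleftrightarrow> p < length (convolution u v)"
      unfolding assms(2) by (auto simp: padded_nth_def convolution_def)
    finally show ?thesis .
  qed
  then have len: "length w = length (convolution u v)" by (metis linorder_neqE_nat less_irrefl)
  show ?thesis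
  proof (rule nth_equalityI[OF len])
    fix p assume "p < length w"
    then show "w ! p = convolution u v ! p"
      using assms(2)[of p] pad_nth_convolution[of u v p] len by (simp add: pad_nth_def)
  qed
qed

lemma map_fst_convolution:
  "map fst (convolution u v) = map Some u @ replicate (length v - length u) None"
  by (intro nth_equalityI) (auto simp: convolution_def padded_nth_def nth_append)

lemma padded_nth_in: "u \<in> lists A \<Longrightarrow> padded_nth u p \<in> padded_alphabet A"
  by (simp add: padded_nth_def padded_alphabet_def in_lists_conv_set)

lemma convolution_in_lists:
  assumes "u \<in> lists A" "v \<in> lists A"
  shows "convolution u v \<in> lists (padded_alphabet A \<times> padded_alphabet A - {(None, None)})"
proof -
  have "(padded_nth u p, padded_nth v p) \<in> padded_alphabet A \<times> padded_alphabet A - {(None, None)}"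
    if "p < max (length u) (length v)" for p
    using that padded_nth_in[OF assms(1), of p] padded_nth_in[OF assms(2), of p]
    by (auto simp: padded_nth_def)
  then show ?thesis unfolding convolution_def in_lists_conv_set by fastforce
qed

definition unpad :: "'a \<Rightarrow> 'a option \<Rightarrow> 'a" where
  "unpad b a = (case a of None \<Rightarrow> b | Some x \<Rightarrow> x)"

lemma unpad_padded_nth: "unpad b (padded_nth u p) = word_tape b u p"
  by (simp add: unpad_def padded_nth_def word_tape_def)

lemma unpad_inj: "unpad b a = unpad b a' \<Longrightarrow> a \<noteq> Some b \<Longrightarrow> a' \<noteq> Some b \<Longrightarrow> a = a'"
  by (auto simp: unpad_def split: option.splits)

lemma foldl_prod:
  "foldl (\<lambda>(s, t) x. (f s x, g t x)) (s0, t0) w = (foldl f s0 w, foldl g t0 w)"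
  by (induction w arbitrary: s0 t0) auto

text \<open>Two automata run in parallel: \<open>pad_check\<close> on the first track, and a scan
  that simulates \<open>T\<close> on that track while \<open>chk\<close> compares the second track
  with one output tape.\<close>

lemma sync_recognizable_output:
  assumes T: "T \<in> class_T" and i: "i < tt_outputs T"
  shows "sync_recognizable (tt_input_alphabet T)
    {(u, v). \<exists>ys. translates T u ys \<and> ys ! i = v}"
proof -
  let ?A = "tt_input_alphabet T" and ?b = "tt_blank T"
  let ?B = "padded_alphabet ?A \<times> padded_alphabet ?A - {(None, None)}"
  let ?R = "{(u, v). \<exists>ys. translates T u ys \<and> ys ! i = v}"
  define inp :: "'b option \<times> 'b option \<Rightarrow> 'b" where "inp x = unpad ?b (fst x)" for x
  \<comment> \<open>Component 0 of a column belongs to the input tape, hence the index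
    \<open>Suc i\<close>.\<close>
  define chk where "chk x c \<longleftrightarrow> c ! Suc i = unpad ?b (snd x)" for x :: "'b option \<times> 'b option" and c
  note wf = class_T_wf[OF T] and A = finite_input_alphabet[OF T]
  have b: "?b \<notin> ?A" using wf by (simp add: wf_transducer_def)
  have chk_pad: "chk (None, None) (replicate (Suc (tt_outputs T)) ?b)"
    using i by (simp add: chk_def unpad_def del: replicate_Suc)
  define step where "step = (\<lambda>(s, t) x. (pad_check s (fst x), scan_step T inp chk t x))"
  define F :: "((bool \<times> bool) \<times> 'a scan_state) set" where "F = {((e, ok), s). ok \<and> s \<in> scan_final T inp chk (None, None)}"
  have "regular_language ?B {w \<in> lists ?B. foldl step ((False, True), scan_init T) w \<in> F}"
  proof (rule regular_language_foldl[where Q = "UNIV \<times> scan_states T"])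
    show "finite ?B" using A by (simp add: padded_alphabet_def)
    show "finite ((UNIV :: (bool \<times> bool) set) \<times> scan_states T)" by (simp add: scan_states_finite[OF wf])
    show "((False, True), scan_init T) \<in> UNIV \<times> scan_states T" by (simp add: scan_init_state[OF wf])
  next
    fix q :: "(bool \<times> bool) \<times> 'a scan_state" and a assume q: "q \<in> UNIV \<times> scan_states T"
    obtain p s where "q = (p, s)" by (rule prod.exhaust)
    with q show "step q a \<in> UNIV \<times> scan_states T" by (simp add: step_def scan_step_closed)
  qed
  moreover have "{w \<in> lists ?B. foldl step ((False, True), scan_init T) w \<in> F}
      = {convolution u v | u v. (u, v) \<in> ?R}"
  proof -
    have fold: "foldl step ((False, True), scan_init T) w \<in> F \<longleftrightarrow>
        (\<exists>u i. map fst w = map Some u @ replicate i None) \<and>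
        foldl (scan_step T inp chk) (scan_init T) w \<in> scan_final T inp chk (None, None)" for w
    proof -
      have "foldl (\<lambda>s x. pad_check s (fst x)) (False, True) w = foldl pad_check (False, True) (map fst w)"
        by (simp add: foldl_map)
      then show ?thesis by (simp add: step_def foldl_prod F_def foldl_pad_check)
    qed
    have scan: "foldl (scan_step T inp chk) (scan_init T) w \<in> scan_final T inp chk (None, None) \<longleftrightarrow>
        (\<exists>n. halts_at T u n \<and> cf_state (tt_run T u n) \<in> tt_accepting T \<and>
          (\<forall>p. (cf_tapes (tt_run T u n) ! Suc i) p = unpad ?b (snd (pad_nth (None, None) w p))))"
      if "map fst w = map Some u @ replicate l None" "u \<in> lists ?A" for w u l
      using that(2) i chk_pad
      by (subst scan_word[OF T, where u = u])
        (auto simp: inp_def map_fst_padded[OF that(1)] unpad_padded_nth chk_def tape_nth_column length_tapes)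
    show ?thesis
    proof (intro equalityI subsetI)
      fix w assume "w \<in> {w \<in> lists ?B. foldl step ((False, True), scan_init T) w \<in> F}"
      then have w: "w \<in> lists ?B" and "foldl step ((False, True), scan_init T) w \<in> F"
        by (simp_all only: mem_Collect_eq)
      from this(2) obtain u l where eq: "map fst w = map Some u @ replicate l None"
        and fin: "foldl (scan_step T inp chk) (scan_init T) w \<in> scan_final T inp chk (None, None)"
        unfolding fold by (elim conjE exE)
      have "Some ` set u \<subseteq> fst ` set w"
        using arg_cong[OF eq, of set] by (simp add: image_Un)
      moreover have "fst ` set w \<subseteq> padded_alphabet ?A" using in_listsD[OF w] by auto
      ultimately have "Some ` set u \<subseteq> padded_alphabet ?A" by (rule subset_trans)
      then have u: "u \<in> lists ?A" by (auto simp: padded_alphabet_def)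
      obtain n where n: "halts_at T u n" "cf_state (tt_run T u n) \<in> tt_accepting T"
        "\<And>p. (cf_tapes (tt_run T u n) ! Suc i) p = unpad ?b (snd (pad_nth (None, None) w p))"
        using fin unfolding scan[OF eq u] by (elim conjE exE) simp
      then have "u \<in> accepted_language T" using u by (auto simp: accepted_language_def)
      \<comment> \<open>Membership in \<open>class_T\<close> guarantees that the output tape holds a
        word over the input alphabet, not just some contents.\<close>
      then obtain ys where ys: "translates T u ys" using class_T_translates[OF T] by blast
      then obtain n' where n': "halts_at T u n'"
        "\<forall>i < tt_outputs T. cf_tapes (tt_run T u n') ! Suc i = word_tape ?b (ys ! i)"
        using translatesD(4)[OF ys] by (elim exE conjE)
      have tape: "cf_tapes (tt_run T u n) ! Suc i = word_tape ?b (ys ! i)"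
        using n'(2) i halts_at_unique[OF n'(1) n(1)] by simp
      have ysA: "ys ! i \<in> lists ?A" using translatesD(5)[OF ys i] .
      \<comment> \<open>The scan compares tape contents only. As the blank is no input letter, equal
        contents mean equal padded letters.\<close>
      have "snd (pad_nth (None, None) w p) = padded_nth (ys ! i) p" for p
      proof (rule unpad_inj)
        show "unpad ?b (snd (pad_nth (None, None) w p)) = unpad ?b (padded_nth (ys ! i) p)"
          using n(3)[of p] tape by (simp add: unpad_padded_nth)
        have "pad_nth (None, None) w p \<in> padded_alphabet ?A \<times> padded_alphabet ?A"
        proof (cases "p < length w")
          case True
          then have "w ! p \<in> ?B" using in_listsD[OF w] nth_mem by blast
          with True show ?thesis by (simp add: pad_nth_def)
        qed (simp add: pad_nth_def padded_alphabet_def)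
        then show "snd (pad_nth (None, None) w p) \<noteq> Some ?b"
          using b by (auto simp: padded_alphabet_def)
        show "padded_nth (ys ! i) p \<noteq> Some ?b"
          using padded_nth_in[OF ysA, of p] b by (auto simp: padded_alphabet_def)
      qed
      moreover have "(None, None) \<notin> set w" using in_listsD[OF w] by blast
      ultimately have "w = convolution u (ys ! i)"
        using map_fst_padded[OF eq] by (intro convolutionI) (simp_all add: prod_eq_iff)
      then show "w \<in> {convolution u v | u v. (u, v) \<in> ?R}" using ys by blast
    next
      fix w assume "w \<in> {convolution u v | u v. (u, v) \<in> ?R}"
      then obtain u ys where w: "w = convolution u (ys ! i)" and ys: "translates T u ys" by auto
      have u: "u \<in> lists ?A" and ysA: "ys ! i \<in> lists ?A"
        using translatesD(2,5)[OF ys] i by blast+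
      obtain n where n: "halts_at T u n" "cf_tapes (tt_run T u n) ! Suc i = word_tape ?b (ys ! i)"
        using translatesD(4)[OF ys] i by blast
      moreover obtain n' where "halts_at T u n'" "cf_state (tt_run T u n') \<in> tt_accepting T"
        using translatesD(1)[OF ys] by (auto simp: accepted_language_def)
      ultimately have "cf_state (tt_run T u n) \<in> tt_accepting T" using halts_at_unique by blast
      with n u have "foldl (scan_step T inp chk) (scan_init T) w \<in> scan_final T inp chk (None, None)"
        using scan[OF map_fst_convolution[of u "ys ! i", folded w] u]
        by (auto simp: w pad_nth_convolution unpad_padded_nth)
      moreover have "w \<in> lists ?B"
        unfolding w using u ysA by (rule convolution_in_lists)
      ultimately show "w \<in> {w \<in> lists ?B. foldl step ((False, True), scan_init T) w \<in> F}"
        unfolding mem_Collect_eq fold using map_fst_convolution[of u "ys ! i", folded w] by blast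
    qed
  qed
  moreover have "?R \<subseteq> lists ?A \<times> lists ?A"
    using translatesD(2,5) i by fast
  ultimately show ?thesis by (simp add: sync_recognizable_def regular_language_def)
qed

lemma word_tape_inject:
  assumes "b \<notin> set u" "b \<notin> set v" "word_tape b u = word_tape b v"
  shows "u = v"
proof -
  have "p < length u \<longleftrightarrow> p < length v" for p
    using fun_cong[OF assms(3), of p] assms(1,2) by (auto simp: word_tape_def split: if_splits)
  then have len: "length u = length v" by (metis linorder_neqE_nat less_irrefl)
  show ?thesis
  proof (rule nth_equalityI[OF len])
    fix p assume "p < length u"
    then show "u ! p = v ! p"
      using fun_cong[OF assms(3), of p] len by (simp add: word_tape_def)
  qed
qed

text \<open>The halting time is unique, and a word without blanks can be recovered from its
  tape.\<close>

lemma translates_unique: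
  assumes "wf_transducer T" "translates T u ys" "translates T u zs"
  shows "ys = zs"
proof -
  obtain n where "halts_at T u n"
    "\<forall>i < tt_outputs T. cf_tapes (tt_run T u n) ! Suc i = word_tape (tt_blank T) (ys ! i)"
    using assms(2) by (auto simp: translates_def)
  moreover obtain n' where "halts_at T u n'"
    "\<forall>i < tt_outputs T. cf_tapes (tt_run T u n') ! Suc i = word_tape (tt_blank T) (zs ! i)"
    using assms(3) by (auto simp: translates_def)
  ultimately have eq: "word_tape (tt_blank T) (ys ! i) = word_tape (tt_blank T) (zs ! i)"
    if "i < tt_outputs T" for i using halts_at_unique that by metis
  have len: "length ys = tt_outputs T" "length zs = tt_outputs T"
    and A: "ys \<in> lists (lists (tt_input_alphabet T))" "zs \<in> lists (lists (tt_input_alphabet T))"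
    using assms(2,3) by (auto simp: translates_def)
  show ?thesis
  proof (rule nth_equalityI)
    fix i assume i: "i < length ys"
    have "ys ! i \<in> lists (tt_input_alphabet T)" "zs ! i \<in> lists (tt_input_alphabet T)"
      using A i len by (metis in_lists_conv_set nth_mem)+
    moreover have "tt_blank T \<notin> tt_input_alphabet T" using assms(1) by (simp add: wf_transducer_def)
    ultimately show "ys ! i = zs ! i"
      using eq[of i] i len by (intro word_tape_inject[of "tt_blank T"]) auto
  qed (simp add: len)
qed

lemma automatic_graph_if_transducer:
  fixes T :: "('q, nat) transducer"
  assumes T: "T \<in> class_T" and k: "tt_outputs T = k"
    and iso: "labeled_graph_iso \<Gamma> (transducer_graph T)"
  shows "automatic_graph k \<Gamma>"
proof -
  let ?L = "accepted_language T"
  obtain g where bij: "bij_betw g (lg_verts \<Gamma>) ?L"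
    and g: "\<And>u v j. u \<in> lg_verts \<Gamma> \<Longrightarrow> v \<in> lg_verts \<Gamma> \<Longrightarrow>
      (u, j, v) \<in> lg_edges \<Gamma> \<longleftrightarrow> (g u, j, g v) \<in> lg_edges (transducer_graph T)"
  proof -
    have "lg_verts (transducer_graph T) = ?L" by (simp add: transducer_graph_def)
    with iso that show thesis unfolding labeled_graph_iso_def by force
  qed
  define f where "f = inv_into (lg_verts \<Gamma>) g"
  have f: "bij_betw f ?L (lg_verts \<Gamma>)" unfolding f_def by (rule bij_betw_inv_into[OF bij])
  have gf: "g (f u) = u" if "u \<in> ?L" for u
    unfolding f_def using bij_betw_inv_into_right[OF bij that] .
  \<comment> \<open>Restricting the endpoints to \<open>?L\<close> is harmless: an accepted word has
    one tuple of outputs, and \<open>class_T\<close> puts these into \<open>?L\<close>.\<close>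
  have edges: "{(u, v). u \<in> ?L \<and> v \<in> ?L \<and> (f u, j, f v) \<in> lg_edges \<Gamma>} =
      {(u, v). \<exists>ys. translates T u ys \<and> ys ! (j - 1) = v}" if j: "j \<in> {1..k}" for j
  proof -
    have "(f u, j, f v) \<in> lg_edges \<Gamma> \<longleftrightarrow> (\<exists>ys. translates T u ys \<and> ys ! (j - 1) = v)"
      if "u \<in> ?L" "v \<in> ?L" for u v
    proof -
      have "f u \<in> lg_verts \<Gamma>" "f v \<in> lg_verts \<Gamma>" using bij_betwE[OF f] that by blast+
      then have "(f u, j, f v) \<in> lg_edges \<Gamma> \<longleftrightarrow> (u, j, v) \<in> lg_edges (transducer_graph T)"
        by (simp only: g gf[OF that(1)] gf[OF that(2)])
      with j k show ?thesis by (simp add: transducer_graph_def)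
    qed
    moreover have "u \<in> ?L \<and> ys ! (j - 1) \<in> ?L" if "translates T u ys" for u ys
    proof -
      have u: "u \<in> ?L" using that by (simp add: translates_def)
      then obtain zs where zs: "translates T u zs" "set zs \<subseteq> ?L" using T by (auto simp: class_T_def)
      have "ys = zs" using translates_unique[OF _ that zs(1)] T by (simp add: class_T_def)
      moreover have "j - 1 < length zs" using zs(1) j k by (auto simp: translates_def)
      ultimately show ?thesis using zs(2) u by (simp add: subset_iff)
    qed
    ultimately show ?thesis by fast
  qed
  have "sync_recognizable (tt_input_alphabet T)
      {(u, v). u \<in> ?L \<and> v \<in> ?L \<and> (f u, j, f v) \<in> lg_edges \<Gamma>}" if "j \<in> {1..k}" for j
    unfolding edges[OF that] using that k by (intro sync_recognizable_output[OF T]) auto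
  then have "\<forall>j \<in> {1..k}. sync_recognizable (tt_input_alphabet T)
      {(u, v). u \<in> ?L \<and> v \<in> ?L \<and> (f u, j, f v) \<in> lg_edges \<Gamma>}" by simp
  with finite_input_alphabet[OF T] regular_accepted_language[OF T] f
  have "finite (tt_input_alphabet T) \<and> regular_language (tt_input_alphabet T) ?L \<and>
      bij_betw f ?L (lg_verts \<Gamma>) \<and> (\<forall>j \<in> {1..k}. sync_recognizable (tt_input_alphabet T)
        {(u, v). u \<in> ?L \<and> v \<in> ?L \<and> (f u, j, f v) \<in> lg_edges \<Gamma>})" by simp
  then show ?thesis unfolding automatic_graph_def
    by (intro exI[of _ "tt_input_alphabet T"] exI[of _ ?L] exI[of _ f]) assumption
qed

section \<open>A transducer that selects a run of a nondeterministic automaton\<close>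

text \<open>\<open>Gather X first n\<close>: right sweep, \<open>X\<close> the set of reachable states of the automaton, \<open>first\<close> true in cell
  \<open>0\<close>, \<open>n\<close> the number of blanks passed. \<open>Choose s\<close>: left sweep, \<open>s\<close> the state of the selected
  run behind the current cell. \<open>Refuse\<close>: left sweep on a rejected input.\<close>

datatype 'q control = Gather "'q set" bool nat | Choose 'q | Refuse | Accept | Reject

lemma finite_controls:
  assumes "finite Q"
  shows "finite ({Gather X first n | X first n. X \<subseteq> Q \<and> n \<le> C} \<union> Choose ` Q \<union> {Refuse, Accept, Reject})"
proof -
  have "{Gather X first n | X first n. X \<subseteq> Q \<and> n \<le> C} =
      (\<lambda>(X, first, n). Gather X first n) ` (Pow Q \<times> UNIV \<times> {..C})"
    by (auto simp: image_iff Bex_def)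
  with assms show ?thesis by simp
qed

text \<open>\<open>N\<close> reads one input letter and \<open>k\<close> output letters per cell. The maps \<open>sc\<close> and \<open>ic\<close> code
  the states of the machine and the notes left on the input tape as natural numbers, the latter above
  the blank \<open>b\<close> and hence above all letters. The machine always turns \<open>C\<close> cells behind
  the first blank, so that \<open>C \<ge> 1\<close> keeps cell \<open>0\<close> from being the turning cell.\<close>

locale recorder =
  fixes A :: "nat set" and k C :: nat
    and N :: "('q, nat option \<times> nat option list) fin_automaton"
    and b :: nat and sc :: "'q control \<Rightarrow> nat" and ic :: "'q set \<times> nat option \<times> bool \<Rightarrow> nat"
  assumes finite_A: "finite A" and k: "1 \<le> k" and C: "1 \<le> C"
    and wf_N: "wf_fin_automaton N"
    and N_alphabet: "fa_alphabet N \<subseteq> padded_alphabet A \<times> {bs \<in> lists (padded_alphabet A). length bs = k}"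
    and b: "\<And>a. a \<in> A \<Longrightarrow> a < b"
    and sc: "inj_on sc ({Gather X first n | X first n. X \<subseteq> fa_states N \<and> n \<le> C} \<union>
      Choose ` fa_states N \<union> {Refuse, Accept, Reject})"
    and ic: "inj_on ic (Pow (fa_states N) \<times> padded_alphabet A \<times> UNIV)" and ic_b: "\<And>x. b < ic x"
begin

definition controls :: "'q control set" where
  "controls = {Gather X first n | X first n. X \<subseteq> fa_states N \<and> n \<le> C} \<union>
      Choose ` fa_states N \<union> {Refuse, Accept, Reject}"

lemma control_iff [simp]:
  "Gather X first n \<in> controls \<longleftrightarrow> X \<subseteq> fa_states N \<and> n \<le> C"
  "Choose s \<in> controls \<longleftrightarrow> s \<in> fa_states N"
  "Refuse \<in> controls" "Accept \<in> controls" "Reject \<in> controls"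
  unfolding controls_def by blast+

definition marks :: "('q set \<times> nat option \<times> bool) set" where
  "marks = Pow (fa_states N) \<times> padded_alphabet A \<times> UNIV"

definition successors :: "'q set \<Rightarrow> nat option \<Rightarrow> 'q set" where
  "successors X a = {s'. \<exists>s \<in> X. \<exists>bs. (s, (a, bs), s') \<in> fa_trans N}"

definition predecessor :: "'q set \<Rightarrow> nat option \<Rightarrow> 'q \<Rightarrow> 'q \<times> nat option list" where
  "predecessor X a s = (SOME z. fst z \<in> X \<and> (fst z, (a, snd z), s) \<in> fa_trans N)"

text \<open>A note on the input tape holds the set before the cell, the overwritten letter and a
  flag for cell 0: all that the left sweep needs to choose a predecessor and to know where to halt.
  The turning cell is left as found. \<open>Choose\<close> sends columns that no run on an input
  word produces to \<open>Reject\<close>, which keeps the transitions total.\<close>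

fun action :: "'q control \<Rightarrow> nat list \<Rightarrow> 'q control \<times> nat list \<times> head_move" where
  "action (Gather X first n) ss =
     (let a = (if hd ss \<in> A then Some (hd ss) else None) in
      if a = None \<and> n = C
      then (if X \<inter> fa_accepting N = {} then Refuse else Choose (SOME s. s \<in> X \<inter> fa_accepting N), ss, Move_Left)
      else (Gather (successors X a) False (if a = None then Suc n else n), ic (X, a, first) # tl ss, Move_Right))"
| "action (Choose s) ss =
     (if hd ss \<in> ic ` marks
      then let (X, a, first) = inv_into marks ic (hd ss); (s', bs) = predecessor X a s in
        if s \<in> successors X a
        then (if first then Accept else Choose s', b # map (unpad b) bs, Move_Left)
        else (Reject, ss, Move_Left)
      else (Reject, ss, Move_Left))"
| "action Refuse ss =
     (if hd ss \<in> ic ` marks \<and> \<not> snd (snd (inv_into marks ic (hd ss))) then Refuse else Reject, ss, Move_Left)"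
| "action c ss = (Reject, ss, Move_Left)"

definition symbols :: "nat set" where
  "symbols = insert b (A \<union> ic ` marks)"

definition machine :: "(nat, nat) transducer" where
  "machine = \<lparr>tt_outputs = k, tt_states = sc ` controls, tt_input_alphabet = A,
     tt_tape_alphabet = symbols, tt_blank = b,
     tt_start = sc (Gather (fa_initial N) True 0), tt_final = {sc Accept, sc Reject},
     tt_accepting = {sc Accept},
     tt_delta = (\<lambda>q ss. case action (inv_into controls sc q) ss of
       (c, ws, d) \<Rightarrow> (sc c, ws, replicate (Suc k) d))\<rparr>"

lemma machine_simps [simp]:
  "tt_outputs machine = k" "tt_states machine = sc ` controls" "tt_input_alphabet machine = A"
  "tt_tape_alphabet machine = symbols" "tt_blank machine = b"
  "tt_start machine = sc (Gather (fa_initial N) True 0)" "tt_final machine = {sc Accept, sc Reject}"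
  "tt_accepting machine = {sc Accept}"
  by (simp_all add: machine_def)

lemma sc_inject: "c \<in> controls \<Longrightarrow> c' \<in> controls \<Longrightarrow> sc c = sc c' \<longleftrightarrow> c = c'"
  using sc unfolding controls_def[symmetric] by (auto dest: inj_onD)

lemma ic_inverse: "x \<in> marks \<Longrightarrow> inv_into marks ic (ic x) = x"
  using ic unfolding marks_def[symmetric] by (rule inv_into_f_f)

lemma delta: "c \<in> controls \<Longrightarrow> tt_delta machine (sc c) ss =
    (case action c ss of (c', ws, d) \<Rightarrow> (sc c', ws, replicate (Suc k) d))"
  using sc unfolding controls_def[symmetric] by (simp add: machine_def)

lemma fa_transD:
  assumes "(s, (a, bs), s') \<in> fa_trans N"
  shows "s \<in> fa_states N" "s' \<in> fa_states N" "a \<in> padded_alphabet A" "bs \<in> lists (padded_alphabet A)" "length bs = k"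
proof -
  have "fa_trans N \<subseteq> fa_states N \<times> fa_alphabet N \<times> fa_states N"
    using wf_N unfolding wf_fin_automaton_def by simp
  with assms N_alphabet show "s \<in> fa_states N" "s' \<in> fa_states N" "a \<in> padded_alphabet A"
      "bs \<in> lists (padded_alphabet A)" "length bs = k"
    by fast+
qed

lemma successors_subset: "successors X a \<subseteq> fa_states N"
  unfolding successors_def using fa_transD(2) by blast

lemma predecessor:
  assumes "s \<in> successors X a" "predecessor X a s = (s', bs)"
  shows "s' \<in> X" "(s', (a, bs), s) \<in> fa_trans N"
proof -
  obtain s0 bs0 where "s0 \<in> X \<and> (s0, (a, bs0), s) \<in> fa_trans N"
    using assms(1) by (auto simp: successors_def)
  then have "fst (predecessor X a s) \<in> X \<and> (fst (predecessor X a s), (a, snd (predecessor X a s)), s) \<in> fa_trans N"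
    unfolding predecessor_def
    by (rule someI[of "\<lambda>z. fst z \<in> X \<and> (fst z, (a, snd z), s) \<in> fa_trans N" "(s0, bs0)", unfolded fst_conv snd_conv])
  then show "s' \<in> X" "(s', (a, bs), s) \<in> fa_trans N" unfolding assms(2) fst_conv snd_conv by blast+
qed

lemma initial_subset: "fa_initial N \<subseteq> fa_states N" and finite_states: "finite (fa_states N)"
  using wf_N unfolding wf_fin_automaton_def by simp_all

lemma finite_marks: "finite marks"
  unfolding marks_def using finite_states finite_A by (simp add: padded_alphabet_def)

lemma unpad_in: "a \<in> padded_alphabet A \<Longrightarrow> unpad b a \<in> insert b A"
  by (auto simp: unpad_def padded_alphabet_def)

lemma action_closed:
  assumes c: "c \<in> controls" and ss: "ss \<in> lists symbols" "length ss = Suc k"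
    and act: "action c ss = (c', ws, d)"
  shows "c' \<in> controls \<and> ws \<in> lists symbols \<and> length ws = Suc k"
proof -
  have tl: "tl ss \<in> lists symbols" "length (tl ss) = k"
    using ss by (auto simp: in_lists_conv_set dest: list.set_sel(2)[rotated])
  show ?thesis
  proof (cases c)
    case (Gather X first n)
    then have X: "X \<subseteq> fa_states N" "n \<le> C" using c by simp_all
    define a where "a = (if hd ss \<in> A then Some (hd ss) else None)"
    have act': "(if a = None \<and> n = C
      then (if X \<inter> fa_accepting N = {} then Refuse else Choose (SOME s. s \<in> X \<inter> fa_accepting N), ss, Move_Left)
      else (Gather (successors X a) False (if a = None then Suc n else n), ic (X, a, first) # tl ss, Move_Right))
      = (c', ws, d)"
      using act unfolding Gather action.simps Let_def a_def .
    show ?thesis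
    proof (cases "a = None \<and> n = C")
      case True
      have "Choose (SOME s. s \<in> X \<inter> fa_accepting N) \<in> controls" if "X \<inter> fa_accepting N \<noteq> {}"
        using some_in_eq[of "X \<inter> fa_accepting N"] that X unfolding control_iff by blast
      moreover have "c' = (if X \<inter> fa_accepting N = {} then Refuse else Choose (SOME s. s \<in> X \<inter> fa_accepting N))"
        "ws = ss" using act' unfolding if_P[OF True] by simp_all
      ultimately have "c' \<in> controls" "ws = ss" by (simp_all only: control_iff split: if_split) blast
      with ss show ?thesis by simp
    next
      case False
      then have "c' = Gather (successors X a) False (if a = None then Suc n else n)"
        and ws: "ws = ic (X, a, first) # tl ss" using act' unfolding if_not_P[OF False] by simp_all
      \<comment> \<open>A blank met with \<open>n = C\<close> belongs to the other branch, so the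
        counter stays within the finite control.\<close>
      moreover have "(if a = None then Suc n else n) \<le> C" using False X by auto
      ultimately have "c' \<in> controls" using successors_subset[of X a] by simp
      moreover have "(X, a, first) \<in> marks" using X by (simp add: marks_def a_def padded_alphabet_def)
      then have "ic (X, a, first) \<in> symbols" by (simp add: symbols_def)
      ultimately show ?thesis using tl ws by simp
    qed
  next
    case (Choose s)
    obtain X a first where i: "inv_into marks ic (hd ss) = (X, a, first)" by (rule prod_cases3)
    obtain s' bs where p: "predecessor X a s = (s', bs)" by (rule prod.exhaust)
    have act': "(if hd ss \<in> ic ` marks then if s \<in> successors X a
        then (if first then Accept else Choose s', b # map (unpad b) bs, Move_Left)
        else (Reject, ss, Move_Left) else (Reject, ss, Move_Left)) = (c', ws, d)"
      using act unfolding Choose action.simps i Let_def prod.case p .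
    show ?thesis
    proof (cases "hd ss \<in> ic ` marks \<and> s \<in> successors X a")
      case True
      then have c': "c' = (if first then Accept else Choose s')" and ws: "ws = b # map (unpad b) bs"
        using act' by simp_all
      \<comment> \<open>Membership in \<open>successors\<close> makes the choice in
        \<open>predecessor\<close> a genuine transition, so the written letters are legal and
        \<open>k\<close> in number.\<close>
      note tr = fa_transD[OF predecessor(2)[OF conjunct2[OF True] p]]
      have "unpad b x \<in> symbols" if "x \<in> set bs" for x
        using unpad_in[OF in_listsD[OF tr(4), THEN bspec, OF that]] by (auto simp: symbols_def)
      moreover have "b \<in> symbols" by (simp add: symbols_def)
      moreover have "c' \<in> controls" unfolding c' using tr(1) by simp
      ultimately show ?thesis unfolding ws using tr(5) by auto
    next
      case False
      then have "c' = Reject" "ws = ss" using act' by (auto split: if_splits)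
      with ss show ?thesis by simp
    qed
  next
    case Refuse
    with act have "c' \<in> {Refuse, Reject}" "ws = ss" by (simp_all split: if_splits)
    with ss show ?thesis by auto
  qed (use act ss in simp_all)
qed

lemma wf_machine: "wf_transducer machine"
proof -
  have "b \<notin> A" using b by blast
  moreover have delta_ok: "case tt_delta machine (sc c) ss of (q', ws, ds) \<Rightarrow>
      q' \<in> sc ` controls \<and> ws \<in> lists (symbols) \<and>
      length ws = Suc k \<and> length ds = Suc k"
    if "c \<in> controls" "ss \<in> lists (symbols)" "length ss = Suc k" for c ss
  proof -
    obtain c' ws d where act: "action c ss = (c', ws, d)" by (metis prod_cases3)
    with action_closed[OF that act] show ?thesis by (simp add: delta[OF that(1)])
  qed
  moreover have "Gather (fa_initial N) True 0 \<in> controls"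
    using initial_subset by simp
  moreover have "\<forall>q \<in> sc ` controls - {sc Accept, sc Reject}. \<forall>ss \<in> lists (symbols).
      length ss = Suc k \<longrightarrow> (case tt_delta machine q ss of (q', ws, ds) \<Rightarrow>
        q' \<in> sc ` controls \<and> ws \<in> lists (symbols) \<and>
        length ws = Suc k \<and> length ds = Suc k)"
  proof (intro ballI impI)
    fix q ss assume q: "q \<in> sc ` controls - {sc Accept, sc Reject}"
      and ss: "ss \<in> lists symbols" "length ss = Suc k"
    from q obtain c where "c \<in> controls" "q = sc c" by blast
    with delta_ok[OF _ ss] show "case tt_delta machine q ss of (q', ws, ds) \<Rightarrow>
        q' \<in> sc ` controls \<and> ws \<in> lists symbols \<and> length ws = Suc k \<and> length ds = Suc k" by simp
  qed
  moreover have "A \<subseteq> symbols" "b \<in> symbols" "finite symbols"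
    using finite_A finite_marks by (auto simp: symbols_def)
  moreover have "finite controls" unfolding controls_def using finite_states by (rule finite_controls)
  ultimately show ?thesis
    using k unfolding wf_transducer_def machine_simps
    by (intro conjI) simp_all
qed

lemma machine_step:
  assumes al: "aligned k (tt_run machine u t) (sc c) h g" and c: "c \<in> controls"
    and act: "action c (g h) = (c', ws, d)" and len: "length ws = Suc k"
  shows "aligned k (tt_run machine u (Suc t)) (sc c') (move_head d h) (g(h := ws))"
    and "all_heads_move machine u t d"
proof -
  have d: "tt_delta machine (sc c) (g h) = (sc c', ws, replicate (Suc (tt_outputs machine)) d)"
    by (simp add: delta[OF c] act)
  have al': "aligned (tt_outputs machine) (tt_run machine u t) (sc c) h g" using al by simp
  show "aligned k (tt_run machine u (Suc t)) (sc c') (move_head d h) (g(h := ws))"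
    using aligned_step[OF al' d] len by (simp add: tt_run_Suc)
  show "all_heads_move machine u t d"
    unfolding all_heads_move_def aligned_action[OF al'] d by simp
qed

lemma not_final: "aligned k (tt_run machine u t) (sc c) h g \<Longrightarrow> c \<in> controls - {Accept, Reject} \<Longrightarrow>
    cf_state (tt_run machine u t) \<notin> tt_final machine"
  using sc_inject[of c Accept] sc_inject[of c Reject] by (simp add: aligned_def)

section \<open>The computation of the recording machine\<close>

primrec reach :: "nat list \<Rightarrow> nat \<Rightarrow> 'q set" where
  "reach u 0 = fa_initial N"
| "reach u (Suc p) = successors (reach u p) (padded_nth u p)"

text \<open>The bound excludes cell \<open>length u + C\<close>, in which the machine turns and
  changes nothing.\<close>

definition recorded :: "nat list \<Rightarrow> nat \<Rightarrow> nat list" where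
  "recorded u p = (if p < length u + C then ic (reach u p, padded_nth u p, p = 0) else b) # replicate k b"

lemma reach_subset: "reach u p \<subseteq> fa_states N"
  using initial_subset successors_subset by (cases p) auto

lemma mark_in: "u \<in> lists A \<Longrightarrow> (reach u p, padded_nth u p, p = 0) \<in> marks"
  using reach_subset by (auto simp: marks_def padded_nth_def padded_alphabet_def in_lists_conv_set)

lemma Gather_control: "t \<le> length u + C \<Longrightarrow> Gather (reach u t) first (t - length u) \<in> controls"
  using reach_subset[of u t] by simp

lemma hd_word_tape: "u \<in> lists A \<Longrightarrow>
    (if word_tape b u t \<in> A then Some (word_tape b u t) else None) = padded_nth u t"
  using b by (auto simp: word_tape_def padded_nth_def in_lists_conv_set)

text \<open>Truncated subtraction yields the blank counter: 0 over the word, then the number of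
  blanks passed.\<close>

lemma gathering:
  assumes u: "u \<in> lists A"
  shows "t \<le> length u + C \<Longrightarrow>
    aligned k (tt_run machine u t) (sc (Gather (reach u t) (t = 0) (t - length u))) t
      (\<lambda>p. if p < t then recorded u p else word_tape b u p # replicate k b) \<and>
    (\<forall>r < t. all_heads_move machine u r Move_Right \<and> cf_state (tt_run machine u r) \<notin> tt_final machine)"
proof (induction t)
  case 0
  show ?case using aligned_init[of machine u] by simp
next
  case (Suc t)
  let ?g = "\<lambda>p. if p < t then recorded u p else word_tape b u p # replicate k b"
  let ?c = "Gather (reach u t) (t = 0) (t - length u)"
  from Suc have al: "aligned k (tt_run machine u t) (sc ?c) t ?g" by simp
  have c: "?c \<in> controls" using Suc.prems by (intro Gather_control) simp
  have "\<not> (padded_nth u t = None \<and> t - length u = C)"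
    using Suc.prems by (auto simp: padded_nth_def)
  moreover have "(if padded_nth u t = None then Suc (t - length u) else t - length u) = Suc t - length u"
    by (auto simp: padded_nth_def)
  moreover have hd: "hd (?g t) = word_tape b u t" by simp
  ultimately have act: "action ?c (?g t) = (Gather (reach u (Suc t)) (Suc t = 0) (Suc t - length u),
      recorded u t, Move_Right)"
    using Suc.prems unfolding action.simps Let_def hd hd_word_tape[OF u]
    by (simp add: recorded_def)
  have "?g(t := recorded u t) = (\<lambda>p. if p < Suc t then recorded u p else word_tape b u p # replicate k b)"
    by (auto simp: less_Suc_eq)
  moreover have "length (recorded u t) = Suc k" by (simp add: recorded_def)
  note st = machine_step[OF al c act this]
  moreover have "cf_state (tt_run machine u t) \<notin> tt_final machine" using not_final[OF al] c by simp
  ultimately show ?case using Suc by (auto simp: less_Suc_eq simp del: machine_simps)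
qed

lemma turning:
  assumes u: "u \<in> lists A"
  defines "m \<equiv> length u + C"
  shows "aligned k (tt_run machine u (Suc m))
      (sc (if reach u m \<inter> fa_accepting N = {} then Refuse
        else Choose (SOME s. s \<in> reach u m \<inter> fa_accepting N))) (m - 1) (recorded u)"
    and "all_heads_move machine u m Move_Left" "cf_state (tt_run machine u m) \<notin> tt_final machine"
proof -
  let ?c = "Gather (reach u m) (m = 0) (m - length u)"
  have eq: "(\<lambda>p. if p < m then recorded u p else word_tape b u p # replicate k b) = recorded u"
    by (auto simp: recorded_def m_def word_tape_def)
  have al: "aligned k (tt_run machine u m) (sc ?c) m (recorded u)"
    using gathering[OF u order_refl, folded m_def, THEN conjunct1] by (simp only: eq)
  have c: "?c \<in> controls" unfolding m_def by (intro Gather_control) simp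
  have "b \<notin> A" using b by blast
  then have act: "action ?c (recorded u m) = (if reach u m \<inter> fa_accepting N = {} then Refuse
        else Choose (SOME s. s \<in> reach u m \<inter> fa_accepting N), recorded u m, Move_Left)"
    by (simp add: recorded_def m_def)
  have len: "length (recorded u m) = Suc k" by (simp add: recorded_def)
  show "aligned k (tt_run machine u (Suc m))
      (sc (if reach u m \<inter> fa_accepting N = {} then Refuse
        else Choose (SOME s. s \<in> reach u m \<inter> fa_accepting N))) (m - 1) (recorded u)"
    and "all_heads_move machine u m Move_Left"
    using machine_step[OF al c act len] by (simp_all only: fun_upd_triv move_head.simps)
  show "cf_state (tt_run machine u m) \<notin> tt_final machine"
    using not_final[OF al] c by blast
qed

lemma refusing:
  assumes u: "u \<in> lists A"
  defines "m \<equiv> length u + C"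
  assumes no: "reach u m \<inter> fa_accepting N = {}"
  shows "s \<le> m \<Longrightarrow>
    aligned k (tt_run machine u (Suc m + s)) (sc (if s < m then Refuse else Reject)) (m - 1 - s) (recorded u) \<and>
    (\<forall>t. m \<le> t \<and> t < Suc m + s \<longrightarrow> all_heads_move machine u t Move_Left \<and>
      cf_state (tt_run machine u t) \<notin> tt_final machine)"
proof (induction s)
  case 0
  have "0 < m" using C by (simp add: m_def)
  then show ?case using turning[OF u] no unfolding m_def[symmetric] by (auto simp: less_Suc_eq)
next
  case (Suc s)
  define p where "p = m - 1 - s"
  \<comment> \<open>For \<open>p = 0\<close> truncated subtraction keeps the heads in cell 0, where
    the flag of the note ends the sweep.\<close>
  have p: "p < m" "p = 0 \<longleftrightarrow> \<not> Suc s < m" "p - 1 = m - 1 - Suc s" using Suc.prems by (auto simp: p_def)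
  from Suc have al: "aligned k (tt_run machine u (Suc m + s)) (sc Refuse) p (recorded u)"
    by (simp add: p_def)
  have c: "Refuse \<in> controls" by simp
  have act: "action Refuse (recorded u p) = (if Suc s < m then Refuse else Reject, recorded u p, Move_Left)"
    using mark_in[OF u, of p] p(1,2) by (simp add: recorded_def m_def ic_inverse)
  have "length (recorded u p) = Suc k" by (simp add: recorded_def)
  note st = machine_step[OF al c act this]
  have "cf_state (tt_run machine u (Suc m + s)) \<notin> tt_final machine"
    using not_final[OF al] c by simp
  moreover have "aligned k (tt_run machine u (Suc m + Suc s)) (sc (if Suc s < m then Refuse else Reject))
      (m - 1 - Suc s) (recorded u)"
    using st(1) by (simp only: fun_upd_triv move_head.simps p(3) add_Suc_right)
  ultimately show ?case using st(2) Suc by (auto simp: less_Suc_eq simp del: machine_simps)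
qed

definition rewritten :: "nat list \<Rightarrow> (nat \<Rightarrow> nat option list) \<Rightarrow> nat \<Rightarrow> nat \<Rightarrow> nat list" where
  "rewritten u y l p =
     (if l \<le> p \<and> p < length u + C then b # map (unpad b) (y p) else recorded u p)"

text \<open>As \<open>q\<close> lies in the reachable set at \<open>m - s\<close>, the note in the
  next cell to the left always offers a predecessor; the path from \<open>q\<close> to an accepting
  state grows at its front, and \<open>y\<close> collects the output letters chosen with it.\<close>

lemma choosing:
  assumes u: "u \<in> lists A"
  defines "m \<equiv> length u + C"
  assumes yes: "reach u m \<inter> fa_accepting N \<noteq> {}"
  shows "s \<le> m \<Longrightarrow> \<exists>q y f. f \<in> fa_accepting N \<and> q \<in> reach u (m - s) \<and>
    fa_path N q (map (\<lambda>p. (padded_nth u p, y p)) [m - s..<m]) f \<and>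
    aligned k (tt_run machine u (Suc m + s)) (sc (if s < m then Choose q else Accept)) (m - 1 - s)
      (rewritten u y (m - s)) \<and>
    (\<forall>t. m \<le> t \<and> t < Suc m + s \<longrightarrow> all_heads_move machine u t Move_Left \<and>
      cf_state (tt_run machine u t) \<notin> tt_final machine)"
proof (induction s)
  case 0
  let ?q = "SOME s. s \<in> reach u m \<inter> fa_accepting N"
  have q: "?q \<in> reach u m" "?q \<in> fa_accepting N"
    using someI_ex[of "\<lambda>s. s \<in> reach u m \<inter> fa_accepting N"] yes by blast+
  have m: "0 < m" using C by (simp add: m_def)
  have "rewritten u y m = recorded u" for y by (rule ext) (auto simp: rewritten_def m_def)
  then have al: "aligned k (tt_run machine u (Suc m)) (sc (Choose ?q)) (m - 1) (rewritten u y m)" for y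
    using turning(1)[OF u, folded m_def] unfolding if_not_P[OF yes] by simp
  show ?case
  proof (intro exI conjI)
    show "?q \<in> fa_accepting N" "?q \<in> reach u (m - 0)" using q by simp_all
    \<comment> \<open>No cell has been rewritten yet, so any \<open>y\<close> will do; the constant
      \<open>[]\<close> is taken.\<close>
    show "fa_path N ?q (map (\<lambda>p. (padded_nth u p, [])) [m - 0..<m]) ?q" by simp
    show "aligned k (tt_run machine u (Suc m + 0)) (sc (if 0 < m then Choose ?q else Accept)) (m - 1 - 0)
        (rewritten u (\<lambda>_. []) (m - 0))" using al m by simp
    show "\<forall>t. m \<le> t \<and> t < Suc m + 0 \<longrightarrow> all_heads_move machine u t Move_Left \<and>
      cf_state (tt_run machine u t) \<notin> tt_final machine"
      using turning(2,3)[OF u, folded m_def] by (auto simp: less_Suc_eq simp del: machine_simps)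
  qed
next
  case (Suc s)
  from Suc.IH[OF Suc_leD[OF Suc.prems]] obtain q y f where IH: "f \<in> fa_accepting N" "q \<in> reach u (m - s)"
    "fa_path N q (map (\<lambda>p. (padded_nth u p, y p)) [m - s..<m]) f"
    "aligned k (tt_run machine u (Suc m + s)) (sc (if s < m then Choose q else Accept)) (m - 1 - s)
      (rewritten u y (m - s))"
    "\<forall>t. m \<le> t \<and> t < Suc m + s \<longrightarrow> all_heads_move machine u t Move_Left \<and>
      cf_state (tt_run machine u t) \<notin> tt_final machine"
    by (elim exE conjE)
  define p where "p = m - 1 - s"
  have p: "p < m" "p = 0 \<longleftrightarrow> \<not> Suc s < m" "p - 1 = m - 1 - Suc s" "m - s = Suc p" "m - Suc s = p"
    using Suc.prems by (auto simp: p_def)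
  have al: "aligned k (tt_run machine u (Suc m + s)) (sc (Choose q)) p (rewritten u y (Suc p))"
    using IH(4) Suc.prems unfolding p(4) p_def[symmetric] by simp
  have q: "q \<in> successors (reach u p) (padded_nth u p)" using IH(2) p(4) by simp
  obtain q' bs where pred: "predecessor (reach u p) (padded_nth u p) q = (q', bs)" by (metis surj_pair)
  note pr = predecessor[OF q pred]
  have c: "Choose q \<in> controls" using subsetD[OF reach_subset IH(2)] by simp
  let ?ws = "b # map (unpad b) bs"
  have act: "action (Choose q) (rewritten u y (Suc p) p) =
      (if Suc s < m then Choose q' else Accept, ?ws, Move_Left)"
    using mark_in[OF u, of p] p(1,2) q pred by (simp add: rewritten_def recorded_def m_def ic_inverse)
  have "length ?ws = Suc k" using fa_transD(5)[OF pr(2)] by simp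
  note st = machine_step[OF al c act this]
  have nf: "cf_state (tt_run machine u (Suc m + s)) \<notin> tt_final machine"
    using not_final[OF al] c by simp
  \<comment> \<open>Changing \<open>y\<close> at \<open>p\<close> alone leaves untouched the cells
    from \<open>Suc p\<close> on, and with them the path already built.\<close>
  have upd: "(rewritten u y (Suc p))(p := ?ws) = rewritten u (y(p := bs)) p"
    using p(1) by (auto simp: rewritten_def m_def)
  have upt: "[p..<m] = p # [Suc p..<m]" using p(1) by (simp add: upt_conv_Cons)
  have eq: "map (\<lambda>i. (padded_nth u i, (y(p := bs)) i)) [Suc p..<m] = map (\<lambda>i. (padded_nth u i, y i)) [Suc p..<m]"
    by simp
  have path: "fa_path N q' (map (\<lambda>i. (padded_nth u i, (y(p := bs)) i)) [p..<m]) f"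
    unfolding upt list.map(2) eq using pr(2) IH(3)[unfolded p(4)] by auto
  show ?case
    unfolding p(5)
  proof (intro exI conjI)
    show "f \<in> fa_accepting N" "q' \<in> reach u p"
      "fa_path N q' (map (\<lambda>i. (padded_nth u i, (y(p := bs)) i)) [p..<m]) f"
      using IH(1) pr(1) path by simp_all
    show "aligned k (tt_run machine u (Suc m + Suc s)) (sc (if Suc s < m then Choose q' else Accept))
        (m - 1 - Suc s) (rewritten u (y(p := bs)) p)"
      using st(1) by (simp only: upd move_head.simps p(3) add_Suc_right)
    show "\<forall>t. m \<le> t \<and> t < Suc m + Suc s \<longrightarrow> all_heads_move machine u t Move_Left \<and>
      cf_state (tt_run machine u t) \<notin> tt_final machine"
      using IH(5) st(2) nf by (auto simp: less_Suc_eq simp del: machine_simps)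
  qed
qed

text \<open>The converse of the selection: the recorded sets see every run of \<open>N\<close>, so
  no word with an accepting run is refused.\<close>

lemma reach_path:
  "fa_path N q (map (\<lambda>i. (padded_nth u i, y i)) [p..<p + l]) f \<Longrightarrow> q \<in> reach u p \<Longrightarrow> f \<in> reach u (p + l)"
proof (induction l arbitrary: p q)
  case (Suc l)
  have "[p..<p + Suc l] = p # [Suc p..<Suc p + l]" by (simp add: upt_conv_Cons)
  with Suc.prems(1) obtain r where r: "(q, (padded_nth u p, y p), r) \<in> fa_trans N"
    "fa_path N r (map (\<lambda>i. (padded_nth u i, y i)) [Suc p..<Suc p + l]) f"
    by (simp del: upt_Suc) blast
  have "r \<in> reach u (Suc p)" using r(1) Suc.prems(2) by (auto simp: successors_def)
  from Suc.IH[OF r(2) this] show ?case by simp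
qed simp

text \<open>The halting time \<open>Suc m + m\<close> counts \<open>m\<close> steps to the right,
  the turn, and one left step in each of the cells m - 1 down to 0; the last of these stays in cell
  0.\<close>

lemma outcome:
  assumes u: "u \<in> lists A"
  defines "m \<equiv> length u + C"
  shows "two_sweep_run machine u m" and "halts_at machine u (Suc m + m)"
    and "cf_state (tt_run machine u (Suc m + m)) = sc Accept \<longleftrightarrow> reach u m \<inter> fa_accepting N \<noteq> {}"
    and "reach u m \<inter> fa_accepting N \<noteq> {} \<Longrightarrow> \<exists>q y f. f \<in> fa_accepting N \<and> q \<in> fa_initial N \<and>
      fa_path N q (map (\<lambda>p. (padded_nth u p, y p)) [0..<m]) f \<and>
      column (tt_run machine u (Suc m + m)) = rewritten u y 0"
proof -
  let ?run = "tt_run machine u"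
  let ?c = "if reach u m \<inter> fa_accepting N = {} then Reject else Accept"
  have "\<exists>g. aligned k (?run (Suc m + m)) (sc ?c) 0 g \<and>
      (\<forall>t. m \<le> t \<and> t < Suc m + m \<longrightarrow> all_heads_move machine u t Move_Left \<and>
        cf_state (?run t) \<notin> tt_final machine) \<and>
      (reach u m \<inter> fa_accepting N \<noteq> {} \<longrightarrow> (\<exists>q y f. f \<in> fa_accepting N \<and> q \<in> fa_initial N \<and>
        fa_path N q (map (\<lambda>p. (padded_nth u p, y p)) [0..<m]) f \<and> g = rewritten u y 0))"
  proof (cases "reach u m \<inter> fa_accepting N = {}")
    case True
    from refusing[OF u this[unfolded m_def] order_refl, folded m_def] True show ?thesis
      by (intro exI[of _ "recorded u"]) (simp del: machine_simps)
  next
    case False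
    from choosing[OF u this[unfolded m_def] order_refl, folded m_def]
    obtain q y f where "f \<in> fa_accepting N" "q \<in> reach u (m - m)"
      "fa_path N q (map (\<lambda>p. (padded_nth u p, y p)) [m - m..<m]) f"
      "aligned k (?run (Suc m + m)) (sc (if m < m then Choose q else Accept)) (m - 1 - m)
        (rewritten u y (m - m))"
      "\<forall>t. m \<le> t \<and> t < Suc m + m \<longrightarrow> all_heads_move machine u t Move_Left \<and>
        cf_state (?run t) \<notin> tt_final machine"
      by (elim exE conjE)
    with False show ?thesis
      by (intro exI[of _ "rewritten u y 0"]) (simp del: machine_simps, blast)
  qed
  then obtain g where g: "aligned k (?run (Suc m + m)) (sc ?c) 0 g"
    and left: "\<And>t. m \<le> t \<Longrightarrow> t < Suc m + m \<Longrightarrow> all_heads_move machine u t Move_Left \<and>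
        cf_state (?run t) \<notin> tt_final machine"
    and acc: "reach u m \<inter> fa_accepting N \<noteq> {} \<Longrightarrow> \<exists>q y f. f \<in> fa_accepting N \<and> q \<in> fa_initial N \<and>
        fa_path N q (map (\<lambda>p. (padded_nth u p, y p)) [0..<m]) f \<and> g = rewritten u y 0"
    by blast
  have right: "all_heads_move machine u t Move_Right \<and> cf_state (?run t) \<notin> tt_final machine" if "t < m" for t
    using gathering[OF u order_refl, folded m_def] that by blast
  have st: "cf_state (?run (Suc m + m)) = sc ?c" and hd: "cf_heads (?run (Suc m + m)) = replicate (Suc k) 0"
    and col: "column (?run (Suc m + m)) = g"
    using g unfolding aligned_def by blast+
  show halts: "halts_at machine u (Suc m + m)"
    unfolding halts_at_def
  proof (intro conjI allI impI)
    show "cf_state (?run (Suc m + m)) \<in> tt_final machine" unfolding st by simp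
    show "cf_state (?run t) \<notin> tt_final machine" if "t < Suc m + m" for t
      using left[OF _ that] right[of t] by (meson not_less)
  qed
  show "two_sweep_run machine u m"
    unfolding two_sweep_run_def
  proof (intro exI conjI)
    show "m \<le> Suc m + m" by simp
    show "halts_at machine u (Suc m + m)" by (rule halts)
    show "\<forall>t<m. all_heads_move machine u t Move_Right" using right by blast
    show "\<forall>t. m \<le> t \<and> t < Suc m + m \<longrightarrow> all_heads_move machine u t Move_Left" using left by blast
    show "cf_heads (?run (Suc m + m)) = replicate (Suc (tt_outputs machine)) 0" using hd by simp
  qed
  show "cf_state (?run (Suc m + m)) = sc Accept \<longleftrightarrow> reach u m \<inter> fa_accepting N \<noteq> {}"
    unfolding st by (simp add: sc_inject)
  show "\<exists>q y f. f \<in> fa_accepting N \<and> q \<in> fa_initial N \<and>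
      fa_path N q (map (\<lambda>p. (padded_nth u p, y p)) [0..<m]) f \<and>
      column (?run (Suc m + m)) = rewritten u y 0" if "reach u m \<inter> fa_accepting N \<noteq> {}"
    using acc[OF that] unfolding col .
qed

end

text \<open>By \<open>path_out\<close> all accepting runs on \<open>u\<close> spell the same
  outputs, so the arbitrary choices at the turn and in \<open>predecessor\<close> do no
  harm.\<close>

locale function_recorder = recorder A k C N b sc ic
  for A k C and N :: "('q, nat option \<times> nat option list) fin_automaton" and b sc ic +
  fixes D :: "nat list set" and out :: "nat list \<Rightarrow> nat list list"
  assumes D: "D \<subseteq> lists A"
    and out: "u \<in> D \<Longrightarrow> length (out u) = k" "u \<in> D \<Longrightarrow> set (out u) \<subseteq> D"
      "u \<in> D \<Longrightarrow> v \<in> set (out u) \<Longrightarrow> length v \<le> length u + C"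
    and path_out: "u \<in> lists A \<Longrightarrow> s \<in> fa_initial N \<Longrightarrow> f \<in> fa_accepting N \<Longrightarrow>
      fa_path N s (map (\<lambda>p. (padded_nth u p, y p)) [0..<length u + C]) f \<Longrightarrow>
      u \<in> D \<and> (\<forall>p < length u + C. y p = map (\<lambda>v. padded_nth v p) (out u))"
    and path_exists: "u \<in> D \<Longrightarrow> \<exists>s \<in> fa_initial N. \<exists>f \<in> fa_accepting N. \<exists>y.
      fa_path N s (map (\<lambda>p. (padded_nth u p, y p)) [0..<length u + C]) f"
begin

lemma reach_accepting:
  assumes "u \<in> lists A"
  shows "reach u (length u + C) \<inter> fa_accepting N \<noteq> {} \<longleftrightarrow> u \<in> D"
proof
  assume "reach u (length u + C) \<inter> fa_accepting N \<noteq> {}"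
  from outcome(4)[OF assms this] path_out[OF assms] show "u \<in> D" by blast
next
  assume "u \<in> D"
  from path_exists[OF this] obtain s f y where *: "s \<in> fa_initial N" "f \<in> fa_accepting N"
    "fa_path N s (map (\<lambda>p. (padded_nth u p, y p)) [0..<length u + C]) f" by blast
  have "f \<in> reach u (0 + (length u + C))"
    by (rule reach_path[of s]) (use * in simp_all)
  with *(2) show "reach u (length u + C) \<inter> fa_accepting N \<noteq> {}" by auto
qed

lemma accepted_machine: "accepted_language machine = D"
proof -
  have "u \<in> accepted_language machine \<longleftrightarrow> u \<in> D" if u: "u \<in> lists A" for u
  proof -
    have "u \<in> accepted_language machine \<longleftrightarrow>
        cf_state (tt_run machine u (Suc (length u + C) + (length u + C))) = sc Accept"
      using u outcome(2)[OF u] halts_at_unique[of machine u] unfolding accepted_language_def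
      by (simp only: machine_simps mem_Collect_eq singleton_iff) metis
    then show ?thesis using outcome(3)[OF u] reach_accepting[OF u] by blast
  qed
  moreover have "accepted_language machine \<subseteq> lists A" unfolding accepted_language_def by auto
  ultimately show ?thesis using D by blast
qed

lemma translates_out:
  assumes "u \<in> D"
  shows "translates machine u (out u)"
proof -
  let ?m = "length u + C"
  have u: "u \<in> lists A" using assms D by blast
  obtain q y f where y: "f \<in> fa_accepting N" "q \<in> fa_initial N"
      "fa_path N q (map (\<lambda>p. (padded_nth u p, y p)) [0..<?m]) f"
      "column (tt_run machine u (Suc ?m + ?m)) = rewritten u y 0"
    using outcome(4)[OF u] reach_accepting[OF u] assms by blast
  have yp: "y p = map (\<lambda>v. padded_nth v p) (out u)" if "p < ?m" for p
    using path_out[OF u y(2,1,3)] that by blast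
  have tape: "cf_tapes (tt_run machine u (Suc ?m + ?m)) ! Suc i = word_tape b (out u ! i)" if i: "i < k" for i
  proof
    fix p
    have "(cf_tapes (tt_run machine u (Suc ?m + ?m)) ! Suc i) p = rewritten u y 0 p ! Suc i"
      using i unfolding y(4)[symmetric] by (intro tape_nth_column) (simp only: length_tapes machine_simps Suc_less_eq)
    also have "\<dots> = word_tape b (out u ! i) p"
    proof (cases "p < ?m")
      case True
      then show ?thesis using i yp[OF True] out(1)[OF assms]
        by (simp add: rewritten_def unpad_padded_nth)
    next
      case False
      \<comment> \<open>Behind the marked cells the output word has ended, by the length bound, so
        both sides are blank.\<close>
      have "out u ! i \<in> set (out u)" using i out(1)[OF assms] by simp
      from out(3)[OF assms this] False i show ?thesis
        by (simp add: rewritten_def recorded_def word_tape_def)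
    qed
    finally show "(cf_tapes (tt_run machine u (Suc ?m + ?m)) ! Suc i) p = word_tape b (out u ! i) p" .
  qed
  have "set (out u) \<subseteq> lists A" using out(2)[OF assms] D by (rule subset_trans)
  then show ?thesis unfolding translates_def accepted_machine machine_simps
    using assms out(1)[OF assms] outcome(2)[OF u] tape by blast
qed

lemma translates_iff: "translates machine u ys \<longleftrightarrow> u \<in> D \<and> ys = out u"
proof
  assume ys: "translates machine u ys"
  then have "u \<in> D" unfolding translates_def accepted_machine by blast
  with translates_unique[OF wf_machine ys] translates_out show "u \<in> D \<and> ys = out u" by blast
qed (use translates_out in blast)

lemma machine_class_T: "machine \<in> class_T"
proof -
  have "\<exists>e \<le> C. two_sweep_run machine x (length x + e)" if "x \<in> lists A" for x
    using outcome(1)[OF that] by blast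
  moreover have "\<exists>ys. translates machine x ys \<and> set ys \<subseteq> accepted_language machine"
    if "x \<in> accepted_language machine" for x
    using that translates_out out(2) unfolding accepted_machine by blast
  ultimately show ?thesis
    using wf_machine unfolding class_T_def machine_simps mem_Collect_eq by blast
qed

end

section \<open>Automata for functional relations\<close>

lemma fa_path_append: "fa_path M p (w @ w') q \<longleftrightarrow> (\<exists>r. fa_path M p w r \<and> fa_path M r w' q)"
  by (induction w arbitrary: p) auto

lemma fa_path_lists: "wf_fin_automaton M \<Longrightarrow> fa_path M p w q \<Longrightarrow> w \<in> lists (fa_alphabet M)"
proof (induction w arbitrary: p)
  case (Cons a w)
  have "fa_trans M \<subseteq> fa_states M \<times> fa_alphabet M \<times> fa_states M"
    using Cons.prems(1) unfolding wf_fin_automaton_def by simp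
  with Cons show ?case by auto
qed simp

lemma fa_path_state:
  "wf_fin_automaton M \<Longrightarrow> fa_path M p w q \<Longrightarrow> p \<in> fa_states M \<Longrightarrow> q \<in> fa_states M"
proof (induction w arbitrary: p)
  case (Cons a w)
  have "fa_trans M \<subseteq> fa_states M \<times> fa_alphabet M \<times> fa_states M"
    using Cons.prems(1) unfolding wf_fin_automaton_def by simp
  with Cons show ?case by auto
qed simp

lemma fa_languageI:
  assumes "wf_fin_automaton M" "p \<in> fa_initial M" "q \<in> fa_accepting M" "fa_path M p w q"
  shows "w \<in> fa_language M"
  unfolding fa_language_def using assms fa_path_lists[OF assms(1,4)] by blast

lemma padded_nth_inject:
  assumes "length u \<le> n" "length v \<le> n" "\<And>p. p < n \<Longrightarrow> padded_nth u p = padded_nth v p"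
  shows "u = v"
proof -
  have "p < length u \<longleftrightarrow> p < length v" for p
    using assms(1,2) assms(3)[of p] by (auto simp: padded_nth_def split: if_splits)
  then have len: "length u = length v" by (metis linorder_neqE_nat less_irrefl)
  show ?thesis
  proof (rule nth_equalityI[OF len])
    fix p assume "p < length u"
    then show "u ! p = v ! p"
      using assms(3)[of p] assms(1) len by (simp add: padded_nth_def)
  qed
qed

lemma convolution_pad:
  assumes "max (length u) (length v) \<le> n"
  shows "map (\<lambda>p. (padded_nth u p, padded_nth v p)) [0..<n] =
    convolution u v @ replicate (n - max (length u) (length v)) (None, None)"
  using assms by (intro nth_equalityI) (auto simp: convolution_def nth_append padded_nth_def)

lemma convolution_inject:
  assumes "convolution u v = convolution u' v'"
  shows "u = u' \<and> v = v'"
proof -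
  have "(padded_nth u p, padded_nth v p) = (padded_nth u' p, padded_nth v' p)" for p
    using pad_nth_convolution[of u v p] pad_nth_convolution[of u' v' p] assms by simp
  then show ?thesis
    using padded_nth_inject[of u "max (length u) (length u')" u'] padded_nth_inject[of v "max (length v) (length v')" v']
    by auto
qed

text \<open>Behind \<open>u\<close> only the second word is left to read; this permits exchanging
  its tail in an accepting run.\<close>

lemma convolution_append:
  "length v = length u \<Longrightarrow> convolution u (v @ z) = convolution u v @ map (\<lambda>b. (None, Some b)) z"
  by (intro nth_equalityI) (auto simp: convolution_def nth_append padded_nth_def)

lemma functional_length_bound:
  fixes M :: "('q, 'a option \<times> 'a option) fin_automaton"
  assumes wf: "wf_fin_automaton M" and lang: "fa_language M = {convolution u v | u v. (u, v) \<in> R}"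
    and fn: "\<And>u v v'. (u, v) \<in> R \<Longrightarrow> (u, v') \<in> R \<Longrightarrow> v = v'"
  shows "\<exists>C. \<forall>(u, v) \<in> R. length v \<le> length u + C"
proof -
  define tail where "tail r z \<longleftrightarrow> (\<exists>q \<in> fa_accepting M. fa_path M r (map (\<lambda>b. (None, Some b)) z) q)"
    for r and z :: "'a list"
  \<comment> \<open>One tail is chosen per state and the longest sets the bound. A state without a
    tail contributes an arbitrary length, which can only enlarge \<open>C\<close>;
    \<open>insert 0\<close> keeps the set nonempty.\<close>
  define C where "C = Max (insert 0 ((\<lambda>r. length (SOME z. tail r z)) ` fa_states M))"
  have fin: "finite (fa_states M)" and init: "fa_initial M \<subseteq> fa_states M"
    using wf unfolding wf_fin_automaton_def by simp_all
  have "length v \<le> length u + C" if R: "(u, v) \<in> R" for u v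
  proof (cases "length v \<le> length u")
    case False
    define v1 z where "v1 = take (length u) v" and "z = drop (length u) v"
    have v: "v = v1 @ z" and v1: "length v1 = length u" using False by (simp_all add: v1_def z_def)
    have "convolution u v \<in> fa_language M" using R lang by blast
    then obtain p q where p: "p \<in> fa_initial M" "q \<in> fa_accepting M" "fa_path M p (convolution u v) q"
      unfolding fa_language_def by blast
    from p(3) obtain r where r: "fa_path M p (convolution u v1) r"
      "fa_path M r (map (\<lambda>b. (None, Some b)) z) q"
      unfolding v convolution_append[OF v1] fa_path_append by blast
    have rs: "r \<in> fa_states M" using fa_path_state[OF wf r(1)] p(1) init by blast
    \<comment> \<open>Only the state \<open>r\<close> behind \<open>u\<close> matters: by functionality \<open>v\<close> must end with the
      word chosen for \<open>r\<close>.\<close>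
    define z' where "z' = (SOME z. tail r z)"
    have "tail r z" using r(2) p(2) unfolding tail_def by blast
    then have "tail r z'" unfolding z'_def by (rule someI)
    then obtain q' where q': "q' \<in> fa_accepting M" "fa_path M r (map (\<lambda>b. (None, Some b)) z') q'"
      unfolding tail_def by blast
    have "fa_path M p (convolution u (v1 @ z')) q'"
      unfolding convolution_append[OF v1] fa_path_append using r(1) q'(2) by blast
    from fa_languageI[OF wf p(1) q'(1) this] obtain u'' v'' where
      "convolution u (v1 @ z') = convolution u'' v''" "(u'', v'') \<in> R" unfolding lang by blast
    with convolution_inject[of u "v1 @ z'"] have "(u, v1 @ z') \<in> R" by blast
    with fn[OF R] have "v = v1 @ z'" by blast
    then have "length v = length u + length z'" using v1 by simp
    moreover have "length z' \<le> C"
      unfolding C_def z'_def using fin rs by (intro Max_ge) auto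
    ultimately show ?thesis by simp
  qed simp
  then show ?thesis by blast
qed

section \<open>Padding the edge automata to a common length and combining them\<close>

text \<open>Accepts the words of \<open>M\<close> followed by at least one letter \<open>(\<diamond>, \<diamond>)\<close>; the state \<^const>\<open>None\<close>
  is entered with the first of them.\<close>

definition pad_closure ::
    "('q, 'a option \<times> 'a option) fin_automaton \<Rightarrow> ('q option, 'a option \<times> 'a option) fin_automaton" where
  "pad_closure M = \<lparr>fa_alphabet = insert (None, None) (fa_alphabet M),
     fa_states = insert None (Some ` fa_states M), fa_initial = Some ` fa_initial M,
     fa_trans = {(Some p, x, Some q) | p x q. (p, x, q) \<in> fa_trans M} \<union>
       {(Some q, (None, None), None) | q. q \<in> fa_accepting M} \<union> {(None, (None, None), None)},
     fa_accepting = {None}\<rparr>"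

lemma wf_pad_closure:
  assumes "wf_fin_automaton M"
  shows "wf_fin_automaton (pad_closure M)"
proof -
  have M: "finite (fa_alphabet M)" "finite (fa_states M)" "fa_initial M \<subseteq> fa_states M"
    "fa_accepting M \<subseteq> fa_states M" "fa_trans M \<subseteq> fa_states M \<times> fa_alphabet M \<times> fa_states M"
    using assms unfolding wf_fin_automaton_def by blast+
  have "fa_trans (pad_closure M) \<subseteq>
      fa_states (pad_closure M) \<times> fa_alphabet (pad_closure M) \<times> fa_states (pad_closure M)"
    using M(4,5) unfolding pad_closure_def fin_automaton.simps by blast
  with M(1-3) show ?thesis
    unfolding wf_fin_automaton_def by (simp add: pad_closure_def image_mono subset_insertI2)
qed

lemma pad_closure_trans:
  "(None, x, s) \<in> fa_trans (pad_closure M) \<longleftrightarrow> x = (None, None) \<and> s = None"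
  "(Some p, x, None) \<in> fa_trans (pad_closure M) \<longleftrightarrow> x = (None, None) \<and> p \<in> fa_accepting M"
  "(Some p, x, Some q) \<in> fa_trans (pad_closure M) \<longleftrightarrow> (p, x, q) \<in> fa_trans M"
  unfolding pad_closure_def fin_automaton.simps by blast+

lemma pad_closure_None: "fa_path (pad_closure M) None w None \<longleftrightarrow> (\<exists>i. w = replicate i (None, None))"
proof (induction w)
  case (Cons x w)
  have "(\<exists>i. x # w = replicate i (None, None)) \<longleftrightarrow> x = (None, None) \<and> (\<exists>i. w = replicate i (None, None))"
    (is "?L \<longleftrightarrow> ?R")
  proof
    assume ?L
    then show ?R by (auto simp: Cons_replicate_eq)
  next
    assume ?R
    then obtain i where "x # w = replicate (Suc i) (None, None)" by auto
    then show ?L by blast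
  qed
  with Cons show ?case by (simp add: pad_closure_trans)
qed simp

lemma pad_closure_Some:
  "fa_path (pad_closure M) (Some p) w None \<longleftrightarrow>
    (\<exists>w' i q. w = w' @ replicate (Suc i) (None, None) \<and> q \<in> fa_accepting M \<and> fa_path M p w' q)"
proof (induction w arbitrary: p)
  case (Cons x w)
  have "fa_path (pad_closure M) (Some p) (x # w) None \<longleftrightarrow>
      (x = (None, None) \<and> p \<in> fa_accepting M \<and> (\<exists>i. w = replicate i (None, None))) \<or>
      (\<exists>r. (p, x, r) \<in> fa_trans M \<and> fa_path (pad_closure M) (Some r) w None)"
    unfolding fa_path.simps split_option_ex pad_closure_trans pad_closure_None by blast
  also have "\<dots> \<longleftrightarrow> (\<exists>w' i q. x # w = w' @ replicate (Suc i) (None, None) \<and>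
      q \<in> fa_accepting M \<and> fa_path M p w' q)" (is "?L1 \<or> ?L2 \<longleftrightarrow> ?R")
  proof
    assume "?L1 \<or> ?L2"
    then show ?R
    proof
      assume ?L1
      then obtain i where "x # w = [] @ replicate (Suc i) (None, None)" "p \<in> fa_accepting M" by auto
      then show ?R by (intro exI[of _ "[]"] exI[of _ i] exI[of _ p]) simp
    next
      assume ?L2
      then obtain r w' i q where "(p, x, r) \<in> fa_trans M" "w = w' @ replicate (Suc i) (None, None)"
        "q \<in> fa_accepting M" "fa_path M r w' q" unfolding Cons.IH by blast
      then show ?R by (intro exI[of _ "x # w'"] exI[of _ i] exI[of _ q]) auto
    qed
  next
    assume ?R
    then obtain w' i q where R: "x # w = w' @ replicate (Suc i) (None, None)" "q \<in> fa_accepting M"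
      "fa_path M p w' q" by blast
    show "?L1 \<or> ?L2"
    proof (cases w')
      case Nil
      with R(1) have "x = (None, None)" "w = replicate i (None, None)" by simp_all
      moreover have "p \<in> fa_accepting M" using R(2,3) Nil by simp
      ultimately show ?thesis by blast
    next
      case (Cons y w'')
      with R(1) have y: "y = x" "w = w'' @ replicate (Suc i) (None, None)" by simp_all
      from R(3) obtain r where "(p, x, r) \<in> fa_trans M" "fa_path M r w'' q"
        unfolding Cons y(1) fa_path.simps by blast
      moreover note y(2)
      ultimately show ?thesis unfolding Cons.IH using R(2) by blast
    qed
  qed
  finally show ?case .
qed simp

text \<open>The obligatory padding letter turns into strict bounds on the lengths. As
  \<open>n\<close> does not depend on \<open>v\<close>, several edge automata can read the same
  cells.\<close>

lemma pad_closure_path: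
  assumes wf: "wf_fin_automaton M" and lang: "fa_language M = {convolution u v | u v. (u, v) \<in> R}"
    and n: "length u < n"
  shows "(\<exists>s \<in> fa_initial (pad_closure M). fa_path (pad_closure M) s (map (\<lambda>p. (padded_nth u p, x p)) [0..<n]) None)
    \<longleftrightarrow> (\<exists>v. (u, v) \<in> R \<and> length v < n \<and> (\<forall>p < n. x p = padded_nth v p))"
proof
  assume "\<exists>s \<in> fa_initial (pad_closure M). fa_path (pad_closure M) s (map (\<lambda>p. (padded_nth u p, x p)) [0..<n]) None"
  then obtain p0 where p0: "p0 \<in> fa_initial M"
    and path: "fa_path (pad_closure M) (Some p0) (map (\<lambda>p. (padded_nth u p, x p)) [0..<n]) None"
    by (auto simp: pad_closure_def)
  from path obtain w' i q where w': "map (\<lambda>p. (padded_nth u p, x p)) [0..<n] = w' @ replicate (Suc i) (None, None)"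
    "q \<in> fa_accepting M" "fa_path M p0 w' q"
    unfolding pad_closure_Some by blast
  from fa_languageI[OF wf p0 w'(2,3)] obtain u' v where v: "w' = convolution u' v" "(u', v) \<in> R"
    unfolding lang by blast
  have "length w' + Suc i = n" using arg_cong[OF w'(1), of length] by simp
  then have len: "max (length u') (length v) + Suc i = n" by (simp add: v(1) convolution_def)
  then have "map (\<lambda>p. (padded_nth u p, x p)) [0..<n] = map (\<lambda>p. (padded_nth u' p, padded_nth v p)) [0..<n]"
    unfolding w'(1) v(1) by (subst convolution_pad) (auto simp flip: replicate_Suc)
  then have eq: "padded_nth u p = padded_nth u' p \<and> x p = padded_nth v p" if "p < n" for p
    using that by simp
  \<comment> \<open>Both words are shorter than \<open>n\<close>, so agreement of their padded
    letters on \<open>n\<close> cells identifies them.\<close>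
  have "u = u'" using eq len n by (intro padded_nth_inject[of u n]) auto
  with v(2) eq len show "\<exists>v. (u, v) \<in> R \<and> length v < n \<and> (\<forall>p < n. x p = padded_nth v p)"
    by (intro exI[of _ v]) auto
next
  assume "\<exists>v. (u, v) \<in> R \<and> length v < n \<and> (\<forall>p < n. x p = padded_nth v p)"
  then obtain v where v: "(u, v) \<in> R" "length v < n" "\<And>p. p < n \<Longrightarrow> x p = padded_nth v p" by blast
  have "map (\<lambda>p. (padded_nth u p, x p)) [0..<n] = map (\<lambda>p. (padded_nth u p, padded_nth v p)) [0..<n]"
    using v(3) by simp
  \<comment> \<open>Both words are shorter than \<open>n\<close>, so the exponent is positive, as
    the closure requires.\<close>
  also have "\<dots> = convolution u v @ replicate (Suc (n - max (length u) (length v) - 1)) (None, None)"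
    using n v(2) by (subst convolution_pad) (simp_all flip: replicate_Suc)
  finally have w: "map (\<lambda>p. (padded_nth u p, x p)) [0..<n] =
      convolution u v @ replicate (Suc (n - max (length u) (length v) - 1)) (None, None)" .
  have "convolution u v \<in> fa_language M" using v(1) lang by blast
  then obtain p q where p: "p \<in> fa_initial M" "q \<in> fa_accepting M" "fa_path M p (convolution u v) q"
    unfolding fa_language_def by blast
  have "fa_path (pad_closure M) (Some p) (map (\<lambda>p. (padded_nth u p, x p)) [0..<n]) None"
    unfolding w pad_closure_Some using p(2,3) by blast
  moreover have "Some p \<in> fa_initial (pad_closure M)" using p(1) by (simp add: pad_closure_def)
  ultimately show "\<exists>s \<in> fa_initial (pad_closure M).
      fa_path (pad_closure M) s (map (\<lambda>p. (padded_nth u p, x p)) [0..<n]) None" by blast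
qed

text \<open>Joining the edge automata on one input track makes a single selected run determine all
  outputs of the same word.\<close>

definition fa_product ::
    "nat \<Rightarrow> 'a set \<Rightarrow> (nat \<Rightarrow> ('q, 'a \<times> 'b) fin_automaton) \<Rightarrow> 'b set \<Rightarrow> ('q list, 'a \<times> 'b list) fin_automaton" where
  "fa_product k A E B = \<lparr>fa_alphabet = A \<times> {bs \<in> lists B. length bs = k},
     fa_states = {ss. length ss = k \<and> (\<forall>j < k. ss ! j \<in> fa_states (E j))},
     fa_initial = {ss. length ss = k \<and> (\<forall>j < k. ss ! j \<in> fa_initial (E j))},
     fa_trans = {(ss, (a, bs), ss') | ss a bs ss'. length ss = k \<and> a \<in> A \<and> bs \<in> lists B \<and> length bs = k \<and>
       length ss' = k \<and> (\<forall>j < k. (ss ! j, (a, bs ! j), ss' ! j) \<in> fa_trans (E j))},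
     fa_accepting = {ss. length ss = k \<and> (\<forall>j < k. ss ! j \<in> fa_accepting (E j))}\<rparr>"

lemma wf_fa_product:
  assumes "finite A" "finite B" "\<And>j. j < k \<Longrightarrow> wf_fin_automaton (E j)"
  shows "wf_fin_automaton (fa_product k A E B)"
proof -
  have E: "finite (fa_states (E j)) \<and> fa_initial (E j) \<subseteq> fa_states (E j) \<and> fa_accepting (E j) \<subseteq> fa_states (E j) \<and>
      fa_trans (E j) \<subseteq> fa_states (E j) \<times> fa_alphabet (E j) \<times> fa_states (E j)" if "j < k" for j
    using assms(3)[OF that] unfolding wf_fin_automaton_def by blast
  have "finite {ss. set ss \<subseteq> (\<Union>j<k. fa_states (E j)) \<and> length ss = k}"
    using E by (intro finite_lists_length_eq) blast
  moreover have "{ss. length ss = k \<and> (\<forall>j < k. ss ! j \<in> fa_states (E j))} \<subseteq>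
      {ss. set ss \<subseteq> (\<Union>j<k. fa_states (E j)) \<and> length ss = k}"
    by (force simp: in_set_conv_nth)
  ultimately have "finite {ss. length ss = k \<and> (\<forall>j < k. ss ! j \<in> fa_states (E j))}"
    by (rule finite_subset[rotated])
  moreover have "finite {bs \<in> lists B. length bs = k}"
    using finite_lists_length_eq[OF assms(2), of k] by (simp add: lists_eq_set)
  moreover have "fa_trans (fa_product k A E B) \<subseteq> fa_states (fa_product k A E B) \<times>
      fa_alphabet (fa_product k A E B) \<times> fa_states (fa_product k A E B)"
  proof
    fix x assume "x \<in> fa_trans (fa_product k A E B)"
    then obtain ss a bs ss' where x: "x = (ss, (a, bs), ss')" "length ss = k" "length ss' = k"
      "a \<in> A" "bs \<in> lists B" "length bs = k"
      and tr: "\<And>j. j < k \<Longrightarrow> (ss ! j, (a, bs ! j), ss' ! j) \<in> fa_trans (E j)"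
      unfolding fa_product_def fin_automaton.simps by blast
    have "ss ! j \<in> fa_states (E j) \<and> ss' ! j \<in> fa_states (E j)" if "j < k" for j
      using E[OF that] tr[OF that] by blast
    with x show "x \<in> fa_states (fa_product k A E B) \<times> fa_alphabet (fa_product k A E B) \<times>
        fa_states (fa_product k A E B)" by (simp add: fa_product_def)
  qed
  moreover have "fa_initial (fa_product k A E B) \<subseteq> fa_states (fa_product k A E B)"
    "fa_accepting (fa_product k A E B) \<subseteq> fa_states (fa_product k A E B)"
    using E unfolding fa_product_def fin_automaton.simps by blast+
  ultimately show ?thesis
    using assms(1) unfolding wf_fin_automaton_def by (simp add: fa_product_def)
qed

lemma fa_product_pathD:
  "fa_path (fa_product k A E B) ss (map (\<lambda>p. (a p, y p)) ps) ss' \<Longrightarrow>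
    (\<forall>p \<in> set ps. length (y p) = k) \<and>
    (\<forall>j < k. fa_path (E j) (ss ! j) (map (\<lambda>p. (a p, y p ! j)) ps) (ss' ! j))"
proof (induction ps arbitrary: ss)
  case (Cons p ps)
  then obtain rs where rs: "(ss, (a p, y p), rs) \<in> fa_trans (fa_product k A E B)"
    "fa_path (fa_product k A E B) rs (map (\<lambda>p. (a p, y p)) ps) ss'" by auto
  from Cons.IH[OF rs(2)] rs(1) show ?case by (auto simp: fa_product_def)
qed simp

lemma fa_product_pathI:
  assumes E: "\<And>j. j < k \<Longrightarrow> wf_fin_automaton (E j)" "\<And>j. j < k \<Longrightarrow> fa_alphabet (E j) \<subseteq> A \<times> B" and k: "0 < k"
    and "length ss' = k"
  shows "length ss = k \<Longrightarrow> \<forall>p \<in> set ps. length (y p) = k \<Longrightarrow>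
    \<forall>j < k. fa_path (E j) (ss ! j) (map (\<lambda>p. (a p, y p ! j)) ps) (ss' ! j) \<Longrightarrow>
    fa_path (fa_product k A E B) ss (map (\<lambda>p. (a p, y p)) ps) ss'"
proof (induction ps arbitrary: ss)
  case Nil
  then have "ss = ss'" using assms(4) by (intro nth_equalityI) simp_all
  then show ?case by simp
next
  case (Cons p ps)
  have "\<forall>j. \<exists>r. j < k \<longrightarrow> (ss ! j, (a p, y p ! j), r) \<in> fa_trans (E j) \<and>
      fa_path (E j) r (map (\<lambda>p. (a p, y p ! j)) ps) (ss' ! j)"
    using Cons.prems(3) by auto
  from choice[OF this] obtain r where
    r: "\<And>j. j < k \<Longrightarrow> (ss ! j, (a p, y p ! j), r j) \<in> fa_trans (E j)"
      "\<And>j. j < k \<Longrightarrow> fa_path (E j) (r j) (map (\<lambda>p. (a p, y p ! j)) ps) (ss' ! j)"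
    by blast
  have letters: "a p \<in> A \<and> y p ! j \<in> B" if "j < k" for j
  proof -
    have "fa_trans (E j) \<subseteq> fa_states (E j) \<times> fa_alphabet (E j) \<times> fa_states (E j)"
      using E(1)[OF that] unfolding wf_fin_automaton_def by blast
    with r(1)[OF that] E(2)[OF that] show ?thesis by blast
  qed
  have "length (y p) = k" using Cons.prems(2) by simp
  moreover from this have "y p \<in> lists B" using letters by (auto simp: in_lists_conv_set in_set_conv_nth)
  \<comment> \<open>That \<open>a p\<close> is a letter is seen from factor 0, which exists since 0
    < k.\<close>
  ultimately have "(ss, (a p, y p), map r [0..<k]) \<in> fa_trans (fa_product k A E B)"
    using Cons.prems(1) letters[OF k] r(1) by (simp add: fa_product_def)
  moreover have "fa_path (fa_product k A E B) (map r [0..<k]) (map (\<lambda>p. (a p, y p)) ps) ss'"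
    using Cons.prems(2) r(2) by (intro Cons.IH) simp_all
  ultimately show ?case unfolding list.map fa_path.simps by blast
qed

section \<open>The equivalence\<close>

lemma transducer_if_automatic_graph:
  assumes k: "k \<ge> 1" and \<Gamma>: "k_labeled_graph k \<Gamma>" and aut: "automatic_graph k \<Gamma>"
  shows "\<exists>T :: (nat, nat) transducer.
    T \<in> class_T \<and> tt_outputs T = k \<and> labeled_graph_iso \<Gamma> (transducer_graph T)"
proof -
  obtain A :: "nat set" and D f where A: "finite A" and reg: "regular_language A D"
    and bij: "bij_betw f D (lg_verts \<Gamma>)"
    and sync: "\<forall>j \<in> {1..k}.
      sync_recognizable A {(u, v). u \<in> D \<and> v \<in> D \<and> (f u, j, f v) \<in> lg_edges \<Gamma>}"
    using aut unfolding automatic_graph_def by (elim exE conjE)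
  note edges = \<Gamma>[unfolded k_labeled_graph_def, THEN conjunct1]
    and unique = \<Gamma>[unfolded k_labeled_graph_def, THEN conjunct2]
    and inj = bij_betw_imp_inj_on[OF bij] and surj = bij_betw_imp_surj_on[OF bij]
  \<comment> \<open>Numbering from 0 matches list positions; the label of \<open>R j\<close> is
    \<open>Suc j\<close>.\<close>
  define R where "R j = {(u, v). u \<in> D \<and> v \<in> D \<and> (f u, Suc j, f v) \<in> lg_edges \<Gamma>}" for j
  let ?B = "padded_alphabet A"
  let ?S = "?B \<times> ?B - {(None, None)}"
  have D: "D \<subseteq> lists A"
    using reg unfolding regular_language_def fa_language_def by auto
  have ex1: "\<exists>!v. (u, v) \<in> R j" if u: "u \<in> D" and j: "j < k" for u j
  proof -
    have fu: "f u \<in> lg_verts \<Gamma>" using surj u by blast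
    have "Suc j \<in> {1..k}" using j by simp
    then have "\<exists>!y. (f u, Suc j, y) \<in> lg_edges \<Gamma>"
      using unique fu by blast
    then obtain y where y: "(f u, Suc j, y) \<in> lg_edges \<Gamma>" "\<And>z. (f u, Suc j, z) \<in> lg_edges \<Gamma> \<Longrightarrow> z = y"
      by (elim ex1E) blast
    have "y \<in> lg_verts \<Gamma>" using edges y(1) by blast
    then obtain v where v: "v \<in> D" "f v = y" unfolding surj[symmetric] by blast
    show ?thesis
    proof (rule ex1I)
      show "(u, v) \<in> R j" using u v y(1) by (simp add: R_def)
      fix v' assume "(u, v') \<in> R j"
      then have "v' \<in> D" "f v' = f v" using y(2) v(2) by (simp_all add: R_def)
      then show "v' = v" using inj_onD[OF inj _ _ v(1)] by blast
    qed
  qed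
  define out where "out u = map (\<lambda>j. THE v. (u, v) \<in> R j) [0..<k]" for u
  have out_len: "length (out u) = k" for u by (simp add: out_def)
  have out_R: "(u, v) \<in> R j \<longleftrightarrow> u \<in> D \<and> v = out u ! j" if j: "j < k" for u v j
  proof (cases "u \<in> D")
    case True
    have the: "out u ! j = (THE v. (u, v) \<in> R j)" using j by (simp add: out_def)
    have "(u, out u ! j) \<in> R j" unfolding the using ex1[OF True j] by (rule theI')
    moreover have "out u ! j = v" if "(u, v) \<in> R j"
      unfolding the using ex1[OF True j] that by (rule the1_equality)
    ultimately show ?thesis using True by auto
  qed (simp add: R_def)
  have "\<forall>j. \<exists>M :: (nat, nat option \<times> nat option) fin_automaton. j < k \<longrightarrow>
      wf_fin_automaton M \<and> fa_alphabet M = ?S \<and> fa_language M = {convolution u v | u v. (u, v) \<in> R j}"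
  proof
    fix j
    show "\<exists>M :: (nat, nat option \<times> nat option) fin_automaton. j < k \<longrightarrow>
      wf_fin_automaton M \<and> fa_alphabet M = ?S \<and> fa_language M = {convolution u v | u v. (u, v) \<in> R j}"
    proof (cases "j < k")
      case True
      then have "sync_recognizable A (R j)" using bspec[OF sync, of "Suc j"] by (simp add: R_def)
      with True show ?thesis unfolding sync_recognizable_def by simp
    qed simp
  qed
  from choice[OF this] obtain M :: "nat \<Rightarrow> (nat, nat option \<times> nat option) fin_automaton" where
    "\<forall>j. j < k \<longrightarrow> wf_fin_automaton (M j) \<and> fa_alphabet (M j) = ?S \<and>
      fa_language (M j) = {convolution u v | u v. (u, v) \<in> R j}"
    by (elim exE)
  then have M: "\<And>j. j < k \<Longrightarrow> wf_fin_automaton (M j)" "\<And>j. j < k \<Longrightarrow> fa_alphabet (M j) = ?S"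
    "\<And>j. j < k \<Longrightarrow> fa_language (M j) = {convolution u v | u v. (u, v) \<in> R j}"
    by simp_all
  have "\<forall>j. \<exists>C. j < k \<longrightarrow> (\<forall>(u, v) \<in> R j. length v \<le> length u + C)"
  proof
    fix j
    show "\<exists>C. j < k \<longrightarrow> (\<forall>(u, v) \<in> R j. length v \<le> length u + C)"
    proof (cases "j < k")
      case True
      have "v = v'" if "(u, v) \<in> R j" "(u, v') \<in> R j" for u v v'
        using that unfolding out_R[OF True] by simp
      from functional_length_bound[OF M(1)[OF True] M(3)[OF True] this] show ?thesis by simp
    qed simp
  qed
  from choice[OF this] obtain c where
    "\<forall>j. j < k \<longrightarrow> (\<forall>(u, v) \<in> R j. length v \<le> length u + c j)"
    by (elim exE)
  then have c: "length v \<le> length u + c j" if "j < k" "(u, v) \<in> R j" for j u v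
    using that by fast
  \<comment> \<open>The maximum bounds every excess length. \<open>Suc\<close> makes the bound
    strict, leaving room for the padding letter that \<open>pad_closure\<close> demands, and gives C
    \<ge> 1.\<close>
  define C where "C = Suc (Max (c ` {..<k}))"
  have out_bound: "length (out u ! j) < length u + C" if "u \<in> D" "j < k" for u j
  proof -
    have "length (out u ! j) \<le> length u + c j" using c[OF that(2)] out_R[OF that(2)] that(1) by blast
    moreover have "c j \<le> Max (c ` {..<k})" using that(2) by (intro Max_ge) auto
    ultimately show ?thesis by (simp add: C_def)
  qed
  define E where "E j = pad_closure (M j)" for j
  define N where "N = fa_product k ?B E ?B"
  have B: "finite ?B" using A by (simp add: padded_alphabet_def)
  have wf_E: "wf_fin_automaton (E j)" if "j < k" for j
    unfolding E_def using M(1)[OF that] by (rule wf_pad_closure)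
  have E_alphabet: "fa_alphabet (E j) \<subseteq> ?B \<times> ?B" if "j < k" for j
    using M(2)[OF that] by (auto simp: E_def pad_closure_def padded_alphabet_def)
  have wf_N: "wf_fin_automaton N"
    unfolding N_def using B B wf_E by (rule wf_fa_product)
  have path: "(\<exists>s \<in> fa_initial (E j). fa_path (E j) s (map (\<lambda>p. (padded_nth u p, x p)) [0..<length u + C]) None)
    \<longleftrightarrow> u \<in> D \<and> (\<forall>p < length u + C. x p = padded_nth (out u ! j) p)" if "j < k" for j u x
  proof -
    have "length u < length u + C" by (simp add: C_def)
    note pad_closure_path[OF M(1)[OF that] M(3)[OF that] this, of x, folded E_def]
    also have "(\<exists>v. (u, v) \<in> R j \<and> length v < length u + C \<and> (\<forall>p < length u + C. x p = padded_nth v p)) \<longleftrightarrow>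
        u \<in> D \<and> (\<forall>p < length u + C. x p = padded_nth (out u ! j) p)"
      unfolding out_R[OF that] using out_bound[OF _ that] by blast
    finally show ?thesis .
  qed
  from A obtain b where b: "\<forall>a \<in> A. a < b"
    unfolding finite_nat_set_iff_bounded by (elim exE)
  have fin: "finite (fa_states N)" using wf_N unfolding wf_fin_automaton_def by (elim conjE)
  obtain sc :: "nat option list control \<Rightarrow> nat" where
    sc: "inj_on sc ({Gather X first n | X first n. X \<subseteq> fa_states N \<and> n \<le> C} \<union>
      Choose ` fa_states N \<union> {Refuse, Accept, Reject})"
    using finite_inj_nat[OF finite_controls[OF fin]] .
  obtain i :: "nat option list set \<times> nat option \<times> bool \<Rightarrow> nat" where
    i: "inj_on i (Pow (fa_states N) \<times> ?B \<times> UNIV)"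
  proof (rule finite_inj_nat)
    show "finite (Pow (fa_states N) \<times> ?B \<times> (UNIV :: bool set))" using fin B by simp
  qed
  \<comment> \<open>The shift puts all notes above the blank, so that none is taken for a letter or
    a blank.\<close>
  define ic where "ic x = Suc b + i x" for x
  have ic: "inj_on ic (Pow (fa_states N) \<times> ?B \<times> UNIV)" and ic_b: "b < ic x" for x
    using i by (simp_all add: inj_on_def ic_def)
  interpret function_recorder A k C N b sc ic D out
  proof
    show "finite A" "1 \<le> k" "wf_fin_automaton N" "D \<subseteq> lists A" using A k wf_N D by simp_all
    show "1 \<le> C" by (simp add: C_def)
    show "fa_alphabet N \<subseteq> ?B \<times> {bs \<in> lists ?B. length bs = k}" by (simp add: N_def fa_product_def)
    show "a < b" if "a \<in> A" for a using b that by blast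
    show "inj_on sc ({Gather X first n | X first n. X \<subseteq> fa_states N \<and> n \<le> C} \<union>
      Choose ` fa_states N \<union> {Refuse, Accept, Reject})" by (rule sc)
    show "inj_on ic (Pow (fa_states N) \<times> ?B \<times> UNIV)" by (rule ic)
    show "b < ic x" for x by (rule ic_b)
    show "length (out u) = k" for u by (rule out_len)
    show "set (out u) \<subseteq> D" if u: "u \<in> D" for u
    proof
      fix v assume "v \<in> set (out u)"
      then obtain j where j: "j < k" "v = out u ! j" by (metis in_set_conv_nth out_len)
      with out_R u have "(u, v) \<in> R j" by blast
      then show "v \<in> D" by (simp add: R_def)
    qed
    show "length v \<le> length u + C" if uv: "u \<in> D" "v \<in> set (out u)" for u v
    proof -
      obtain j where "j < k" "v = out u ! j" using uv(2) by (metis in_set_conv_nth out_len)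
      with out_bound[OF uv(1)] show ?thesis by (simp add: less_imp_le)
    qed
    show "u \<in> D \<and> (\<forall>p < length u + C. y p = map (\<lambda>v. padded_nth v p) (out u))"
      if st: "u \<in> lists A" "s \<in> fa_initial N" "t \<in> fa_accepting N"
        "fa_path N s (map (\<lambda>p. (padded_nth u p, y p)) [0..<length u + C]) t" for u s t y
    proof -
      have len: "length (y p) = k" if "p < length u + C" for p
        using fa_product_pathD[OF st(4)[unfolded N_def]] \<open>p < length u + C\<close> by simp
      have y: "u \<in> D \<and> (\<forall>p < length u + C. y p ! j = padded_nth (out u ! j) p)" if j: "j < k" for j
      proof -
        have "s ! j \<in> fa_initial (E j)" "t ! j = None"
          using st(2,3) j by (simp_all add: N_def fa_product_def E_def pad_closure_def)
        moreover have "fa_path (E j) (s ! j) (map (\<lambda>p. (padded_nth u p, y p ! j)) [0..<length u + C]) (t ! j)"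
          using fa_product_pathD[OF st(4)[unfolded N_def]] j by blast
        ultimately have "\<exists>s \<in> fa_initial (E j).
            fa_path (E j) s (map (\<lambda>p. (padded_nth u p, y p ! j)) [0..<length u + C]) None" by auto
        then show ?thesis unfolding path[OF j] .
      qed
      \<comment> \<open>Membership in \<open>D\<close> is certified by the first edge automaton,
        whose relation is defined on exactly the words of \<open>D\<close>.\<close>
      have "u \<in> D" using y[of 0] k by simp
      moreover have "y p = map (\<lambda>v. padded_nth v p) (out u)" if "p < length u + C" for p
        using len[OF that] y that out_len[of u] by (intro nth_equalityI) simp_all
      ultimately show ?thesis by blast
    qed
    show "\<exists>s \<in> fa_initial N. \<exists>t \<in> fa_accepting N. \<exists>y.
        fa_path N s (map (\<lambda>p. (padded_nth u p, y p)) [0..<length u + C]) t" if u: "u \<in> D" for u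
    proof -
      define y where "y p = map (\<lambda>v. padded_nth v p) (out u)" for p
      have "\<forall>j. \<exists>s. j < k \<longrightarrow> s \<in> fa_initial (E j) \<and>
          fa_path (E j) s (map (\<lambda>p. (padded_nth u p, y p ! j)) [0..<length u + C]) None"
      proof
        fix j
        show "\<exists>s. j < k \<longrightarrow> s \<in> fa_initial (E j) \<and>
          fa_path (E j) s (map (\<lambda>p. (padded_nth u p, y p ! j)) [0..<length u + C]) None"
        proof (cases "j < k")
          case True
          have "y p ! j = padded_nth (out u ! j) p" for p using True out_len[of u] by (simp add: y_def)
          then show ?thesis using path[OF True, of u "\<lambda>p. y p ! j"] u by blast
        qed simp
      qed
      from choice[OF this] obtain s where s: "\<And>j. j < k \<Longrightarrow> s j \<in> fa_initial (E j) \<and>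
          fa_path (E j) (s j) (map (\<lambda>p. (padded_nth u p, y p ! j)) [0..<length u + C]) None"
        by blast
      have "fa_path N (map s [0..<k]) (map (\<lambda>p. (padded_nth u p, y p)) [0..<length u + C]) (replicate k None)"
        unfolding N_def
        using s k out_len[of u] by (intro fa_product_pathI wf_E E_alphabet) (simp_all add: y_def)
      moreover have "map s [0..<k] \<in> fa_initial N" using s by (simp add: N_def fa_product_def)
      moreover have "replicate k None \<in> fa_accepting N"
        by (simp add: N_def fa_product_def E_def pad_closure_def)
      ultimately show ?thesis by blast
    qed
  qed
  define g where "g = inv_into D f"
  have g: "bij_betw g (lg_verts \<Gamma>) D" unfolding g_def by (rule bij_betw_inv_into[OF bij])
  have "labeled_graph_iso \<Gamma> (transducer_graph machine)"
    unfolding labeled_graph_iso_def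
  proof (intro exI conjI ballI allI)
    show "bij_betw g (lg_verts \<Gamma>) (lg_verts (transducer_graph machine))"
      using g by (simp add: transducer_graph_def accepted_machine)
    fix u v j assume uv: "u \<in> lg_verts \<Gamma>" "v \<in> lg_verts \<Gamma>"
    have D': "g u \<in> D" "g v \<in> D" using bij_betwE[OF g] uv by blast+
    have fg: "f (g u) = u" "f (g v) = v"
      unfolding g_def using bij_betw_inv_into_right[OF bij] uv by blast+
    have "(g u, j, g v) \<in> lg_edges (transducer_graph machine) \<longleftrightarrow> j \<in> {1..k} \<and> out (g u) ! (j - 1) = g v"
      using D'(1) by (simp add: transducer_graph_def translates_iff)
    also have "\<dots> \<longleftrightarrow> j \<in> {1..k} \<and> (g u, g v) \<in> R (j - 1)"
    proof (cases "j \<in> {1..k}")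
      case True
      then have "j - 1 < k" by auto
      from out_R[OF this] D'(1) show ?thesis by auto
    qed blast
    also have "\<dots> \<longleftrightarrow> j \<in> {1..k} \<and> (u, j, v) \<in> lg_edges \<Gamma>"
      using D' fg by (auto simp: R_def)
    also have "\<dots> \<longleftrightarrow> (u, j, v) \<in> lg_edges \<Gamma>"
      using edges by blast
    finally show "(u, j, v) \<in> lg_edges \<Gamma> \<longleftrightarrow> (g u, j, g v) \<in> lg_edges (transducer_graph machine)" by simp
  qed
  then show ?thesis using machine_class_T by (intro exI[of _ machine]) simp
qed

theorem theorem3:
  fixes k :: nat and \<Gamma> :: "'v labeled_graph"
  assumes "k \<ge> 1"
    and "k_labeled_graph k \<Gamma>"
  shows "automatic_graph k \<Gamma> \<longleftrightarrow>
    (\<exists>T :: (nat, nat) transducer.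
       T \<in> class_T \<and> tt_outputs T = k \<and> labeled_graph_iso \<Gamma> (transducer_graph T))"
  using transducer_if_automatic_graph[OF assms] automatic_graph_if_transducer by blast

end
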